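(* Let $g$ be a continuous probability density on $\mathbb{R}^n$, and consider one of the three settings (1) one-sample, (2) two-sample, (3) $F$-statistic described in the context, with $T$, $K_g$ and $G$ as defined there, and assume the corresponding integrability condition given there. For $u>0$, $\alpha\in\{1,2\}$ and $m,k\ge1$ put $$d_{\alpha,m,k}(u)=\frac1{u^{\alpha(k+1)/2}}\left[C_1\sup_{\|\mathbf{x}\|\le u^{-\alpha/2}}\|\nabla G(\mathbf{x})\|+C_2\frac{K_g}{\alpha}\frac1{u^{\alpha/2}}\right],$$ $$C_1=\mathrm{Vol}(B_k),\qquad C_2=\frac{k(k+m)}{m(k+2)}\cdot\frac{(k/m)^{k/2}}{B(m/2,k/2)}.$$ If $G$ is differentiable in some neighborhood of zero, then for any $u>0$ the following inequalities hold: (1) for the Student one-sample $t$-statistic, $|\mathbf{P}(T>u)-K_g\,t_{n-1}(u)|\le d_{2,1,n-1}(u)$; (2) for the two-sample $t$-statistic, $|\mathbf{P}(T>u)-K_g\,t_{n-2}(u)|\le d_{2,1,n-2}(u)$; (3) for the $F$-statistic, $|\mathbf{P}(T>u)-K_g\,F_{n_1-1,n_2-1}(u)|\le d_{1,n_1-1,n_2-1}(u)$.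
   Context: $B_k$ is the unit ball of $\mathbb{R}^k$, $B(\cdot,\cdot)$ the Beta function, $t_k(u)$ the tail $\mathbf{P}(\cdot>u)$ of the Student $t$-distribution with $k$ degrees of freedom, $F_{m,k}(u)$ the tail of the $F$-distribution with $m,k$ degrees of freedom. Sample variances use the divisor (sample size minus one). Vectors $\mathbf{e}_i$ are standard basis vectors. (1) One-sample: $n\ge2$, $\mathbf{X}\in\mathbb{R}^n$ has density $g$, $T=\sqrt n\,\overline{\mathbf{X}}/S$ (sample mean, sample standard deviation). $\mathbf{I}=(1/\sqrt n,\dots,1/\sqrt n)$, $L=\mathrm{span}(\mathbf{I})$. Integrability condition: for some $\varepsilon>0$, $\int_0^\infty r^{n-1}\sup_{\|\boldsymbol\xi\|<\varepsilon,\boldsymbol\xi\in L^\perp}g(r(\mathbf{I}+\boldsymbol\xi))\,dr<\infty$. $K_g=\frac{2\pi^{n/2}}{\Gamma(n/2)}\int_0^\infty r^{n-1}g(r\mathbf{I})\,dr$. For $\mathbf{t}\in\mathbb{R}^{n-1}$, $$G(\mathbf{t})=(n-1)^{(n-1)/2}\int_0^\infty r^{n-1}g\big(r(\mathbf{I}+A\mathbf{v}(\mathbf{t}))\big)\,dr,\quad \mathbf{v}(\mathbf{t})=(n-1)^{1/2}(t_1,\dots,t_{n-1},0),$$ with $A$ an orthogonal linear operator on $\mathbb{R}^n$ such that $A\mathbf{e}_n=\mathbf{I}$. (2) Two-sample: $n_1,n_2\ge2$, $n=n_1+n_2$, constants $a,b>0$, $\mathbf{X}\in\mathbb{R}^n$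 has density $g$, $T=\big(\frac1{n_1}\sum_{i\le n_1}X_i-\frac1{n_2}\sum_{i>n_1}X_i\big)/\sqrt{aS_1^2+bS_2^2}$, with $S_1^2,S_2^2$ the sample variances of the first $n_1$ and the last $n_2$ coordinates (the Student two-sample statistic is $a=\frac{n_1-1}{n-2}(\frac1{n_1}+\frac1{n_2})$, $b=\frac{n_2-1}{n-2}(\frac1{n_1}+\frac1{n_2})$). $\mathbf{I}_1$ has first $n_1$ coordinates $1/\sqrt{n_1}$, others $0$; $\mathbf{I}_2$ has last $n_2$ coordinates $1/\sqrt{n_2}$, others $0$; $L=\mathrm{span}(\mathbf{I}_1,\mathbf{I}_2)$; $\omega_0=\arccos\sqrt{n_2/n}$; $\mathbf{w}(\omega)=\cos(\omega-\omega_0)\mathbf{I}_1+\sin(\omega-\omega_0)\mathbf{I}_2$. Integrability condition: for some $\varepsilon>0$, $\int_{-\pi/2}^{\pi/2}\cos(\omega)^{n-2}\int_0^\infty r^{n-1}\sup_{\|\boldsymbol\xi\|<\varepsilon,\boldsymbol\xi\in L^\perp}g(r(\mathbf{w}(\omega)+\boldsymbol\xi))\,dr\,d\omega<\infty$. With $M=\left(\frac{n_1-1}{a}\right)^{(n_1-1)/2}\left(\frac{n_2-1}{b}\right)^{(n_2-1)/2}\left(\frac1{n_1}+\frac1{n_2}\right)^{(n-2)/2}$, $$K_g=\frac{2\pi^{(n-1)/2}M}{\Gamma(\frac{n-1}2)(n-2)^{(n-2)/2}}\int_{-\pi/2}^{\pi/2}\cos(\omega)^{n-2}\int_0^\infty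 r^{n-1}g(r\mathbf{w}(\omega))\,dr\,d\omega.$$ For $\mathbf{t}\in\mathbb{R}^{n-2}$, $$G(\mathbf{t})=M\int_{-\pi/2}^{\pi/2}\cos(\omega)^{n-2}\int_0^\infty r^{n-1}g\big(r(\mathbf{w}(\omega)+A\mathbf{v}(\mathbf{t},\omega-\omega_0))\big)\,dr\,d\omega,$$ $\mathbf{v}(\mathbf{t},\omega)=(c_1(\omega)t_1,\dots,c_1(\omega)t_{n_1-1},0,c_2(\omega)t_{n_1},\dots,c_2(\omega)t_{n-2},0)$, $c_1(\omega)=\sqrt{\frac1{n_1}+\frac1{n_2}}\sqrt{\frac{n_1-1}{a}}\cos\omega$, $c_2(\omega)=\sqrt{\frac1{n_1}+\frac1{n_2}}\sqrt{\frac{n_2-1}{b}}\cos\omega$, with $A$ an orthogonal linear operator on $\mathbb{R}^n$ such that $A\mathbf{e}_{n_1}=\mathbf{I}_1$ and $A\mathbf{e}_n=\mathbf{I}_2$. (3) $F$-statistic: $n_1,n_2\ge2$, $n=n_1+n_2$, $(\mathbf{X},\mathbf{Y})\in\mathbb{R}^{n_1}\times\mathbb{R}^{n_2}$ has density $g(\mathbf{x},\mathbf{y})$, $T=S_1^2/S_2^2$ is the ratio of the sample variances of $\mathbf{X}$ and $\mathbf{Y}$. $s_1(\mathbf{x})$ is the sample standard deviation of $\mathbf{x}\in\mathbb{R}^{n_1}$, $\mathbf{J}=(1/\sqrt{n_2},\dots,1/\sqrt{n_2})\in\mathbb{R}^{n_2}$, $L=\mathrm{span}(\mathbf{J})$.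 Integrability condition: for some $\varepsilon>0$, $\int_{\mathbb{R}^{n_1}}s_1(\mathbf{x})^{n_2-1}\int_{-\infty}^\infty\sup_{\|\boldsymbol\xi\|<\varepsilon,\boldsymbol\xi\in L^\perp}g(\mathbf{x},r\mathbf{J}+s_1(\mathbf{x})\boldsymbol\xi)\,dr\,d\mathbf{x}<\infty$. $$K_g=\frac{\Gamma(\frac{n_1-1}2)(\pi(n_1-1))^{(n_2-1)/2}}{\Gamma(\frac{n-2}2)}\int_{\mathbb{R}^{n_1}}s_1(\mathbf{x})^{n_2-1}\int_{-\infty}^\infty g(\mathbf{x},r\mathbf{J})\,dr\,d\mathbf{x}.$$ For $\mathbf{t}\in\mathbb{R}^{n_2-1}$, $$G(\mathbf{t})=(n_2-1)^{(n_2-1)/2}\int_{\mathbb{R}^{n_1}}s_1(\mathbf{x})^{n_2-1}\int_{-\infty}^\infty g\big(\mathbf{x},\,r\mathbf{J}+\sqrt{n_2-1}\,s_1(\mathbf{x})\,A(t_1,\dots,t_{n_2-1},0)\big)\,dr\,d\mathbf{x},$$ with $A$ an orthogonal linear operator on $\mathbb{R}^{n_2}$ such that $A\mathbf{e}_{n_2}=\mathbf{J}$.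
   Formalization: In case (2), G is defined with v(t,ω) in place of v(t,ω−ω0), and when (n1−1)/a ≠ (n2−1)/b the operator A must also map vectors supported on the first n1 coordinates to such vectors; as printed the inequality fails. The sup of ‖∇G‖ counts as ∞ if G is not differentiable on the ball. *)

theory Defs
  imports "HOL-Probability.Probability"
begin

(* Conventions.  Coordinates are indexed by finite types.  A sample of size at least 2 which
   contains a distinguished coordinate (the paper's e_n, e_{n1}, ...) is indexed by 'k option:
   the coordinates Some i come first and None is the last one, so CARD('k option) = CARD('k) + 1
   is an arbitrary number >= 2.  Two consecutive blocks are indexed by a sum type.

   Integrals of non-negative functions are taken in ennreal, so that divergence is visible and
   an iterated integral never hits a default value. *)

section \<open>Sample statistics\<close>

definition sample_mean :: "real ^ 'i \<Rightarrow> real" where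
  "sample_mean x = (\<Sum>i\<in>UNIV. x $ i) / real CARD('i)"

definition sample_var :: "real ^ 'i \<Rightarrow> real" where
  "sample_var x = (\<Sum>i\<in>UNIV. (x $ i - sample_mean x)\<^sup>2) / (real CARD('i) - 1)"

definition sample_sd :: "real ^ 'i \<Rightarrow> real" where
  "sample_sd x = sqrt (sample_var x)"

definition block1 :: "real ^ ('i::finite + 'j::finite) \<Rightarrow> real ^ 'i" where
  "block1 x = (\<chi> i. x $ Inl i)"

definition block2 :: "real ^ ('i::finite + 'j::finite) \<Rightarrow> real ^ 'j" where
  "block2 x = (\<chi> j. x $ Inr j)"

definition one_sample_T :: "real ^ 'i \<Rightarrow> real" where
  "one_sample_T x = sqrt (real CARD('i)) * sample_mean x / sample_sd x"

definition two_sample_T :: "real \<Rightarrow> real \<Rightarrow> real ^ ('i::finite + 'j::finite) \<Rightarrow> real" where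
  "two_sample_T a b x =
     (sample_mean (block1 x) - sample_mean (block2 x)) /
     sqrt (a * sample_var (block1 x) + b * sample_var (block2 x))"

definition F_T :: "(real ^ 'i) \<times> (real ^ 'j) \<Rightarrow> real" where
  "F_T z = sample_var (fst z) / sample_var (snd z)"


section \<open>Reference distributions\<close>

definition student_density :: "nat \<Rightarrow> real \<Rightarrow> real" where
  "student_density k x =
     Gamma ((real k + 1) / 2) / (sqrt (real k * pi) * Gamma (real k / 2)) *
     (1 + x\<^sup>2 / real k) powr (- (real k + 1) / 2)"

definition student_tail :: "nat \<Rightarrow> real \<Rightarrow> real" where
  "student_tail k u = measure (density lborel (\<lambda>x. ennreal (student_density k x))) {u<..}"

definition F_density :: "nat \<Rightarrow> nat \<Rightarrow> real \<Rightarrow> real" where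
  "F_density m k x =
     (if x > 0
      then (real m / real k) powr (real m / 2) * x powr (real m / 2 - 1) *
           (1 + real m / real k * x) powr (- (real m + real k) / 2) / Beta (real m / 2) (real k / 2)
      else 0)"

definition F_tail :: "nat \<Rightarrow> nat \<Rightarrow> real \<Rightarrow> real" where
  "F_tail m k u = measure (density lborel (\<lambda>x. ennreal (F_density m k x))) {u<..}"


section \<open>Densities, differentiability and the error bound\<close>

definition has_continuous_density ::
  "'a measure \<Rightarrow> ('a \<Rightarrow> 'b::euclidean_space) \<Rightarrow> ('b \<Rightarrow> real) \<Rightarrow> bool" where
  "has_continuous_density M X g \<longleftrightarrow>
     prob_space M \<and> distributed M lborel X (\<lambda>x. ennreal (g x)) \<and>
     (\<forall>x. g x \<ge> 0) \<and> continuous_on UNIV g"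

definition differentiable_at_point :: "('b::euclidean_space \<Rightarrow> ennreal) \<Rightarrow> 'b \<Rightarrow> bool" where
  "differentiable_at_point G x \<longleftrightarrow>
     (\<forall>\<^sub>F y in nhds x. G y < \<infinity>) \<and> (\<lambda>y. enn2real (G y)) differentiable (at x)"

definition differentiable_near_0 :: "('b::euclidean_space \<Rightarrow> ennreal) \<Rightarrow> bool" where
  "differentiable_near_0 G \<longleftrightarrow> (\<forall>\<^sub>F x in nhds 0. differentiable_at_point G x)"

definition gradient :: "('b::euclidean_space \<Rightarrow> real) \<Rightarrow> 'b \<Rightarrow> 'b" where
  "gradient f x = (THE D. GDERIV f x :> D)"

(* G is only assumed to be differentiable near 0, whereas the supremum in the error bound extends
   over a ball of arbitrary radius: a point without a gradient contributes infinity, so that the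
   bound carries information exactly when the supremum makes sense and is finite. *)
definition gradient_norm :: "('b::euclidean_space \<Rightarrow> ennreal) \<Rightarrow> 'b \<Rightarrow> ennreal" where
  "gradient_norm G x =
     (if differentiable_at_point G x
      then ennreal (norm (gradient (\<lambda>y. enn2real (G y)) x)) else \<infinity>)"

(* d_{alpha,m,k}(u) for given K = K_g and G, where G is a function on R^k. *)
definition tail_error ::
  "nat \<Rightarrow> nat \<Rightarrow> nat \<Rightarrow> real \<Rightarrow> ('b::euclidean_space \<Rightarrow> ennreal) \<Rightarrow> real \<Rightarrow> ennreal" where
  "tail_error \<alpha> m k K G u =
    (let C1 = unit_ball_vol (real k);
         C2 = (real k * (real k + real m)) / (real m * (real k + 2)) *
              ((real k / real m) powr (real k / 2) / Beta (real m / 2) (real k / 2))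
     in ennreal (1 / u powr (real \<alpha> * (real k + 1) / 2)) *
        (ennreal C1 * (SUP x\<in>{x. norm x \<le> u powr (- real \<alpha> / 2)}. gradient_norm G x) +
         ennreal (C2 * (K / real \<alpha>) * (1 / u powr (real \<alpha> / 2)))))"


section \<open>One-sample setting\<close>

(* The vector I (and J for the F-statistic). *)
definition unit_diag :: "real ^ 'i" where
  "unit_diag = (\<chi> i. 1 / sqrt (real CARD('i)))"

definition one_sample_integrable :: "(real ^ 'i \<Rightarrow> real) \<Rightarrow> bool" where
  "one_sample_integrable g \<longleftrightarrow>
     (\<exists>\<epsilon>>0. (\<integral>\<^sup>+r\<in>{0<..}. ennreal (r ^ (CARD('i) - 1)) *
        (SUP \<xi>\<in>{\<xi>. norm \<xi> < \<epsilon> \<and> \<xi> \<in> orthogonal_comp (span {unit_diag})}.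
           ennreal (g (r *\<^sub>R (unit_diag + \<xi>)))) \<partial>lborel) < \<infinity>)"

(* The integral in each K_g below is finite under the corresponding integrability condition. *)
definition one_sample_K :: "(real ^ 'i \<Rightarrow> real) \<Rightarrow> real" where
  "one_sample_K g =
     2 * pi powr (real CARD('i) / 2) / Gamma (real CARD('i) / 2) *
     enn2real (\<integral>\<^sup>+r\<in>{0<..}. ennreal (r ^ (CARD('i) - 1) * g (r *\<^sub>R unit_diag)) \<partial>lborel)"

(* The vector (t_1, ..., t_k, 0). *)
definition append_zero :: "real ^ 'k \<Rightarrow> real ^ ('k::finite option)" where
  "append_zero t = (\<chi> i. case i of Some j \<Rightarrow> t $ j | None \<Rightarrow> 0)"

definition one_sample_v :: "real ^ 'k \<Rightarrow> real ^ ('k::finite option)" where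
  "one_sample_v t = sqrt (real CARD('k option) - 1) *\<^sub>R append_zero t"

definition one_sample_rotation :: "(real ^ ('k::finite option) \<Rightarrow> real ^ ('k::finite option)) \<Rightarrow> bool" where
  "one_sample_rotation A \<longleftrightarrow> orthogonal_transformation A \<and> A (axis None 1) = unit_diag"

definition one_sample_G ::
  "(real ^ ('k::finite option) \<Rightarrow> real ^ ('k::finite option)) \<Rightarrow> (real ^ ('k::finite option) \<Rightarrow> real) \<Rightarrow>
   real ^ 'k \<Rightarrow> ennreal" where
  "one_sample_G A g t =
     ennreal ((real CARD('k option) - 1) powr ((real CARD('k option) - 1) / 2)) *
     (\<integral>\<^sup>+r\<in>{0<..}. ennreal (r ^ (CARD('k option) - 1) *
        g (r *\<^sub>R (unit_diag + A (one_sample_v t)))) \<partial>lborel)"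


section \<open>Two-sample setting\<close>

definition I1 :: "real ^ ('i::finite + 'j::finite)" where
  "I1 = (\<chi> l. case l of Inl _ \<Rightarrow> 1 / sqrt (real CARD('i)) | Inr _ \<Rightarrow> 0)"

definition I2 :: "real ^ ('i::finite + 'j::finite)" where
  "I2 = (\<chi> l. case l of Inl _ \<Rightarrow> 0 | Inr _ \<Rightarrow> 1 / sqrt (real CARD('j)))"

definition omega0 :: "nat \<Rightarrow> nat \<Rightarrow> real" where
  "omega0 n1 n2 = arccos (sqrt (real n2 / real (n1 + n2)))"

definition two_sample_w :: "real \<Rightarrow> real ^ ('i::finite + 'j::finite)" where
  "two_sample_w \<omega> =
     cos (\<omega> - omega0 CARD('i) CARD('j)) *\<^sub>R I1 + sin (\<omega> - omega0 CARD('i) CARD('j)) *\<^sub>R I2"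

definition two_sample_integrable :: "(real ^ ('i::finite + 'j::finite) \<Rightarrow> real) \<Rightarrow> bool" where
  "two_sample_integrable g \<longleftrightarrow>
     (\<exists>\<epsilon>>0. (\<integral>\<^sup>+\<omega>\<in>{-pi/2..pi/2}. ennreal (cos \<omega> ^ (CARD('i) + CARD('j) - 2)) *
        (\<integral>\<^sup>+r\<in>{0<..}. ennreal (r ^ (CARD('i) + CARD('j) - 1)) *
           (SUP \<xi>\<in>{\<xi>. norm \<xi> < \<epsilon> \<and> \<xi> \<in> orthogonal_comp (span {I1, I2})}.
              ennreal (g (r *\<^sub>R (two_sample_w \<omega> + \<xi>)))) \<partial>lborel) \<partial>lborel) < \<infinity>)"

definition two_sample_M :: "real \<Rightarrow> real \<Rightarrow> nat \<Rightarrow> nat \<Rightarrow> real" where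
  "two_sample_M a b n1 n2 =
     ((real n1 - 1) / a) powr ((real n1 - 1) / 2) *
     ((real n2 - 1) / b) powr ((real n2 - 1) / 2) *
     (1 / real n1 + 1 / real n2) powr ((real (n1 + n2) - 2) / 2)"

definition two_sample_K :: "real \<Rightarrow> real \<Rightarrow> (real ^ ('i::finite + 'j::finite) \<Rightarrow> real) \<Rightarrow> real" where
  "two_sample_K a b g =
    (let n = CARD('i) + CARD('j) in
     2 * pi powr ((real n - 1) / 2) * two_sample_M a b CARD('i) CARD('j) /
     (Gamma ((real n - 1) / 2) * (real n - 2) powr ((real n - 2) / 2)) *
     enn2real (\<integral>\<^sup>+\<omega>\<in>{-pi/2..pi/2}. ennreal (cos \<omega> ^ (n - 2)) *
        (\<integral>\<^sup>+r\<in>{0<..}. ennreal (r ^ (n - 1) * g (r *\<^sub>R two_sample_w \<omega>)) \<partial>lborel) \<partial>lborel))"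

(* two_sample_c a n1 n2 n1 is c_1 and two_sample_c b n1 n2 n2 is c_2. *)
definition two_sample_c :: "real \<Rightarrow> nat \<Rightarrow> nat \<Rightarrow> nat \<Rightarrow> real \<Rightarrow> real" where
  "two_sample_c a n1 n2 ni \<omega> =
     sqrt (1 / real n1 + 1 / real n2) * sqrt ((real ni - 1) / a) * cos \<omega>"

definition two_sample_v ::
  "real \<Rightarrow> real \<Rightarrow> real ^ ('p::finite + 'q::finite) \<Rightarrow> real \<Rightarrow> real ^ ('p::finite option + 'q::finite option)" where
  "two_sample_v a b t \<omega> =
    (let n1 = CARD('p option); n2 = CARD('q option) in
     \<chi> l. case l of
        Inl None \<Rightarrow> 0
      | Inl (Some i) \<Rightarrow> two_sample_c a n1 n2 n1 \<omega> * t $ Inl i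
      | Inr None \<Rightarrow> 0
      | Inr (Some j) \<Rightarrow> two_sample_c b n1 n2 n2 \<omega> * t $ Inr j)"

(* If c_1 = c_2, any orthogonal A with A e_{n1} = I1, A e_n = I2
   will do.  Otherwise t is scaled differently in the two blocks, and A has to map vectors
   supported on the first block to vectors supported on the first block (hence, being orthogonal,
   also second block to second block); if A mixes the blocks, G is not related to T. *)
definition two_sample_rotation ::
  "real \<Rightarrow> real \<Rightarrow>
   (real ^ ('p::finite option + 'q::finite option) \<Rightarrow> real ^ ('p::finite option + 'q::finite option)) \<Rightarrow> bool" where
  "two_sample_rotation a b A \<longleftrightarrow>
     orthogonal_transformation A \<and> A (axis (Inl None) 1) = I1 \<and> A (axis (Inr None) 1) = I2 \<and>
     ((real CARD('p option) - 1) / a \<noteq> (real CARD('q option) - 1) / b \<longrightarrow>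
        (\<forall>x. block2 x = 0 \<longrightarrow> block2 (A x) = 0))"

(* The factor cos omega in v has to be the one occurring in the difference of the sample means of
   r w(omega), which is r sqrt(1/n1 + 1/n2) cos omega; then T > u is equivalent to norm t < 1/u for
   X = r (w(omega) + A v(t, omega)) with cos omega > 0, and M cos(omega)^(n-2) r^(n-1) is the
   Jacobian.  In particular the second argument of v is omega, not the shifted angle
   omega - omega0 that enters w. *)
definition two_sample_G ::
  "real \<Rightarrow> real \<Rightarrow> (real ^ ('p::finite option + 'q::finite option) \<Rightarrow> real ^ ('p::finite option + 'q::finite option)) \<Rightarrow>
   (real ^ ('p::finite option + 'q::finite option) \<Rightarrow> real) \<Rightarrow> real ^ ('p::finite + 'q::finite) \<Rightarrow> ennreal" where
  "two_sample_G a b A g t =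
    (let n = CARD('p option) + CARD('q option) in
     ennreal (two_sample_M a b CARD('p option) CARD('q option)) *
     (\<integral>\<^sup>+\<omega>\<in>{-pi/2..pi/2}. ennreal (cos \<omega> ^ (n - 2)) *
        (\<integral>\<^sup>+r\<in>{0<..}. ennreal (r ^ (n - 1) *
           g (r *\<^sub>R (two_sample_w \<omega> + A (two_sample_v a b t \<omega>)))) \<partial>lborel) \<partial>lborel))"


section \<open>Setting of the F-statistic\<close>

definition F_integrable :: "((real ^ 'i) \<times> (real ^ 'j) \<Rightarrow> real) \<Rightarrow> bool" where
  "F_integrable g \<longleftrightarrow>
     (\<exists>\<epsilon>>0. (\<integral>\<^sup>+x. ennreal (sample_sd x ^ (CARD('j) - 1)) *
        (\<integral>\<^sup>+r. (SUP \<xi>\<in>{\<xi>. norm \<xi> < \<epsilon> \<and> \<xi> \<in> orthogonal_comp (span {unit_diag})}.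
           ennreal (g (x, r *\<^sub>R unit_diag + sample_sd x *\<^sub>R \<xi>))) \<partial>lborel) \<partial>lborel) < \<infinity>)"

definition F_K :: "((real ^ 'i) \<times> (real ^ 'j) \<Rightarrow> real) \<Rightarrow> real" where
  "F_K g =
    (let n1 = real CARD('i); n2 = real CARD('j) in
     Gamma ((n1 - 1) / 2) * (pi * (n1 - 1)) powr ((n2 - 1) / 2) / Gamma ((n1 + n2 - 2) / 2) *
     enn2real (\<integral>\<^sup>+x. ennreal (sample_sd x ^ (CARD('j) - 1)) *
        (\<integral>\<^sup>+r. ennreal (g (x, r *\<^sub>R unit_diag)) \<partial>lborel) \<partial>lborel))"

definition F_G ::
  "(real ^ ('k::finite option) \<Rightarrow> real ^ ('k::finite option)) \<Rightarrow> ((real ^ 'i) \<times> (real ^ ('k::finite option)) \<Rightarrow> real) \<Rightarrow>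
   real ^ 'k \<Rightarrow> ennreal" where
  "F_G A g t =
    (let n2 = real CARD('k option) in
     ennreal ((n2 - 1) powr ((n2 - 1) / 2)) *
     (\<integral>\<^sup>+x. ennreal (sample_sd x ^ (CARD('k option) - 1)) *
        (\<integral>\<^sup>+r. ennreal (g (x, r *\<^sub>R unit_diag +
           (sqrt (n2 - 1) * sample_sd x) *\<^sub>R A (append_zero t))) \<partial>lborel) \<partial>lborel))"

end

theory Submission
  imports Defs
begin

text \<open>
  In coordinates adapted to the statistic, an outcome is \<open>r\<close> times a point of the space \<open>L\<close> plus \<open>A t\<close>
  suitably scaled by \<open>r\<close> (or by the standard deviation of the first sample), and there \<open>T = 1/\<parallel>t\<parallel>\<close>
  in the two \<open>t\<close>-settings and \<open>T = 1/\<parallel>t\<parallel>\<^sup>2\<close> for the \<open>F\<close>-statistic.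
  The Jacobian of this change of variables is the weight in \<open>G\<close>, so that \<open>P(T > u)\<close> is the integral
  of \<open>G\<close> over the ball of radius \<open>\<rho> = u powr (- \<alpha> / 2)\<close>. By the mean value theorem this
  differs from \<open>G(0)\<close> times the volume of the ball by at most \<open>\<rho> sup \<parallel>\<nabla>G\<parallel>\<close> times the volume.
  The constant \<open>K\<^sub>g\<close> makes \<open>K\<^sub>g\<close> times the leading term of the reference tail equal to
  \<open>G(0)\<close> times that volume, and Bernoulli's inequality bounds the remainder of the reference tail.
\<close>

section \<open>Isometries preserve Lebesgue measure\<close>

text \<open>Each change of variables splits into an isometry, a positive diagonal scaling and, for
  two samples, plane polar coordinates; this replaces a general substitution formula with Jacobian
  determinants. Since the integrals live in \<open>ennreal\<close>, their order can be exchanged by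
  Tonelli's theorem. The mean value step takes place on the whole closed ball of radius \<rho>,
  however large. The convention that \<open>gradient_norm\<close> is infinite at bad points makes
  this possible: either the supremum is infinite and the bound is trivial, or its finiteness makes
  \<open>G\<close> finite and differentiable on that ball. The two error terms come from consecutive
  powers: \<rho> to the power k + 1 is the prefactor of \<open>tail_error\<close> and goes with the
  gradient, while \<rho> to the power k + 2 is the order of the remainder of the reference tail.
  Thus \<open>K_g\<close> is the ratio of the leading coefficients of the two tails.\<close>

lemma borel_measurable_linear:
  fixes f :: "'a::euclidean_space \<Rightarrow> 'b::euclidean_space"
  shows "linear f \<Longrightarrow> f \<in> borel_measurable borel"
  by (intro borel_measurable_continuous_onI linear_continuous_on linear_conv_bounded_linear[THEN iffD1])

lemma nn_integral_lborel_translate: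
  fixes h :: "'a::euclidean_space \<Rightarrow> ennreal"
  assumes [measurable]: "h \<in> borel_measurable borel"
  shows "(\<integral>\<^sup>+x. h (c + x) \<partial>lborel) = (\<integral>\<^sup>+x. h x \<partial>lborel)"
proof -
  have "(\<integral>\<^sup>+x. h x \<partial>distr lborel borel ((+) c)) = (\<integral>\<^sup>+x. h (c + x) \<partial>lborel)"
    by (subst nn_integral_distr) auto
  then show ?thesis
    by (simp add: lborel_distr_plus)
qed

lemma nn_integral_lborel_reflect:
  fixes h :: "'a::euclidean_space \<Rightarrow> ennreal"
  assumes [measurable]: "h \<in> borel_measurable borel"
  shows "(\<integral>\<^sup>+x. h (c - x) \<partial>lborel) = (\<integral>\<^sup>+x. h x \<partial>lborel)"
proof -
  have "lborel = distr lborel borel (\<lambda>x. c - x)"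
    using lborel_affine[of "-1" c] by (simp add: density_1)
  then have "(\<integral>\<^sup>+x. h x \<partial>lborel) = (\<integral>\<^sup>+x. h x \<partial>distr lborel borel (\<lambda>x. c - x))"
    by simp
  then show ?thesis
    by (simp add: nn_integral_distr)
qed

text \<open>This is the uniqueness argument for Haar measure: by Fubini and invariance under translations
  \<open>\<integral>h(f z) dz \<sqdot> |B| = \<integral>h(y) dy \<sqdot> |f\<^sup>-\<^sup>1 B|\<close> for every \<open>B\<close>, and for a ball the two volumes agree.\<close>
lemma nn_integral_isometry:
  fixes f :: "'a::euclidean_space \<Rightarrow> 'b::euclidean_space" and h :: "'b \<Rightarrow> ennreal"
  assumes f: "linear f" and iso: "\<And>x. norm (f x) = norm x" and dim: "DIM('a) = DIM('b)"
    and [measurable]: "h \<in> borel_measurable borel"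
  shows "(\<integral>\<^sup>+x. h (f x) \<partial>lborel) = (\<integral>\<^sup>+y. h y \<partial>lborel)"
proof -
  interpret linear f by fact
  \<comment> \<open>A norm-preserving linear map is injective, and equal dimensions make it
    surjective.\<close>
  have "inj f"
    using iso by (auto simp: linear_injective_0[OF f]) (metis norm_eq_zero)
  then have "dim (range f) = DIM('b)"
    using dim dim_image_eq[OF f, of UNIV] by simp
  then have "surj f"
    using linear_subspace_image[OF f subspace_UNIV] by (metis dim_eq_full span_eq_iff)
  then obtain fi where fi: "\<And>y. f (fi y) = y"
    by (metis surjD)
  have [measurable]: "f \<in> borel_measurable borel"
    using f by (rule borel_measurable_linear)
  define B :: "'b set" where "B = ball 0 1"
  have [measurable]: "B \<in> sets borel"
    by (simp add: B_def)
  define v where "v = emeasure lborel B"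
  have v: "v = (\<integral>\<^sup>+y. indicator B y \<partial>lborel)"
    by (simp add: v_def)
  have vf: "v = (\<integral>\<^sup>+x. indicator B (f x) \<partial>lborel)"
  proof -
    have "indicator B (f x) = (indicator (ball 0 1) x :: ennreal)" for x
      by (simp add: B_def indicator_def iso)
    then show ?thesis
      by (simp add: v_def B_def emeasure_ball dim)
  qed
  have "(\<integral>\<^sup>+x. h (f x) \<partial>lborel) * v = (\<integral>\<^sup>+x. h (f x) * (\<integral>\<^sup>+y. indicator B y \<partial>lborel) \<partial>lborel)"
    unfolding v by (subst nn_integral_multc) auto
  also have "\<dots> = (\<integral>\<^sup>+x. h (f x) * (\<integral>\<^sup>+y. indicator B (f x + y) \<partial>lborel) \<partial>lborel)"
    by (subst nn_integral_lborel_translate) auto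
  also have "\<dots> = (\<integral>\<^sup>+x. \<integral>\<^sup>+y. h (f x) * indicator B (f x + y) \<partial>lborel \<partial>lborel)"
    by (subst nn_integral_cmult) auto
  also have "\<dots> = (\<integral>\<^sup>+y. \<integral>\<^sup>+x. h (f x) * indicator B (f x + y) \<partial>lborel \<partial>lborel)"
    by (intro lborel_pair.Fubini') measurable
  also have "\<dots> = (\<integral>\<^sup>+y. \<integral>\<^sup>+x. h (f x - y) * indicator B (f x) \<partial>lborel \<partial>lborel)"
  proof (rule nn_integral_cong)
    \<comment> \<open>Surjectivity enters here: translating x by a preimage \<open>fi y\<close> of y
      shifts \<open>f x\<close> by y.\<close>
    fix y
    have "(\<integral>\<^sup>+x. h (f x - y) * indicator B (f x) \<partial>lborel)
        = (\<integral>\<^sup>+x. h (f (fi y + x) - y) * indicator B (f (fi y + x)) \<partial>lborel)"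
      by (rule nn_integral_lborel_translate[symmetric]) measurable
    also have "\<dots> = (\<integral>\<^sup>+x. h (f x) * indicator B (f x + y) \<partial>lborel)"
      by (simp add: add fi add.commute)
    finally show "(\<integral>\<^sup>+x. h (f x) * indicator B (f x + y) \<partial>lborel)
        = (\<integral>\<^sup>+x. h (f x - y) * indicator B (f x) \<partial>lborel)" ..
  qed
  also have "\<dots> = (\<integral>\<^sup>+x. \<integral>\<^sup>+y. h (f x - y) * indicator B (f x) \<partial>lborel \<partial>lborel)"
    by (intro lborel_pair.Fubini') measurable
  also have "\<dots> = (\<integral>\<^sup>+x. (\<integral>\<^sup>+y. h (f x - y) \<partial>lborel) * indicator B (f x) \<partial>lborel)"
    by (subst nn_integral_multc) auto
  also have "\<dots> = (\<integral>\<^sup>+x. (\<integral>\<^sup>+y. h y \<partial>lborel) * indicator B (f x) \<partial>lborel)"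
    by (subst nn_integral_lborel_reflect) auto
  also have "\<dots> = (\<integral>\<^sup>+y. h y \<partial>lborel) * v"
    unfolding vf by (subst nn_integral_cmult) auto
  finally have "v * (\<integral>\<^sup>+x. h (f x) \<partial>lborel) = v * (\<integral>\<^sup>+y. h y \<partial>lborel)"
    by (simp add: mult.commute)
  \<comment> \<open>Cancelling a factor in \<open>ennreal\<close> requires it to be neither 0 nor
    infinite, which is why the test set is a ball.\<close>
  moreover have "v \<noteq> 0" "v \<noteq> \<infinity>"
    using unit_ball_vol_pos[of "DIM('b)"] by (auto simp: v_def B_def emeasure_ball simp del: unit_ball_vol_pos)
  ultimately show ?thesis
    by (simp add: ennreal_mult_cancel_left)
qed

text \<open>The norm on a product type is the Euclidean one, so an orthonormal splitting of the
  space is an isometry from a product, and Tonelli's theorem turns it into an iterated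
  integral.\<close>

lemma nn_integral_isometry_pair:
  fixes f :: "'a::euclidean_space \<times> 'b::euclidean_space \<Rightarrow> 'c::euclidean_space" and h :: "'c \<Rightarrow> ennreal"
  assumes f: "linear f" and iso: "\<And>x. norm (f x) = norm x" and dim: "DIM('a) + DIM('b) = DIM('c)"
    and [measurable]: "h \<in> borel_measurable borel"
  shows "(\<integral>\<^sup>+y. h y \<partial>lborel) = (\<integral>\<^sup>+r. \<integral>\<^sup>+t. h (f (r, t)) \<partial>lborel \<partial>lborel)"
proof -
  have [measurable]: "f \<in> borel_measurable (lborel \<Otimes>\<^sub>M lborel)"
    unfolding lborel_prod using borel_measurable_linear[OF f] by simp
  have "(\<integral>\<^sup>+y. h y \<partial>lborel) = (\<integral>\<^sup>+x. h (f x) \<partial>(lborel \<Otimes>\<^sub>M lborel))"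
    unfolding lborel_prod using f iso dim by (intro nn_integral_isometry[symmetric]) auto
  also have "\<dots> = (\<integral>\<^sup>+r. \<integral>\<^sup>+t. h (f (r, t)) \<partial>lborel \<partial>lborel)"
    by (intro lborel.nn_integral_fst[symmetric]) measurable
  finally show ?thesis .
qed

section \<open>Scaling and polar coordinates\<close>

lemma nn_integral_lborel_scale:
  fixes h :: "'a::euclidean_space \<Rightarrow> ennreal"
  assumes [measurable]: "h \<in> borel_measurable borel" and "c > 0"
  shows "(\<integral>\<^sup>+x. h x \<partial>lborel) = ennreal (c ^ DIM('a)) * (\<integral>\<^sup>+x. h (c *\<^sub>R x) \<partial>lborel)"
  using \<open>c > 0\<close>
  by (subst lborel_affine[of c 0]) (auto simp: nn_integral_density nn_integral_distr nn_integral_cmult)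

text \<open>The substitution \<open>q = tan \<omega>\<close>, stated for measures so that it serves
  every non-negative measurable integrand. It suffices to compare intervals, where it is the
  fundamental theorem of calculus for \<open>tan\<close>.\<close>

lemma lborel_eq_distr_tan:
  "lborel = distr (density lborel (\<lambda>\<omega>. ennreal (1 / (cos \<omega>)\<^sup>2) * indicator {-pi/2<..<pi/2} \<omega>)) borel tan"
proof (rule lborel_eqI)
  fix l u :: real
  assume "\<And>b. b \<in> Basis \<Longrightarrow> l \<bullet> b \<le> u \<bullet> b"
  then have lu: "l \<le> u" by simp
  have [measurable]: "(tan :: real \<Rightarrow> real) \<in> borel_measurable borel"
    unfolding tan_def by measurable
  let ?D = "\<lambda>\<omega>. ennreal (1 / (cos \<omega>)\<^sup>2)"
  have iff: "-pi/2 < \<omega> \<and> \<omega> < pi/2 \<and> l < tan \<omega> \<and> tan \<omega> < u \<longleftrightarrow> arctan l < \<omega> \<and> \<omega> < arctan u" for \<omega>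
  proof
    assume *: "-pi/2 < \<omega> \<and> \<omega> < pi/2 \<and> l < tan \<omega> \<and> tan \<omega> < u"
    then have "arctan (tan \<omega>) = \<omega>" by (intro arctan_tan) auto
    with * show "arctan l < \<omega> \<and> \<omega> < arctan u" by (metis arctan_less_iff)
  next
    assume *: "arctan l < \<omega> \<and> \<omega> < arctan u"
    then have 1: "-pi/2 < \<omega> \<and> \<omega> < pi/2" using arctan_lbound[of l] arctan_ubound[of u] by linarith
    then have "arctan (tan \<omega>) = \<omega>" by (intro arctan_tan) auto
    with 1 * show "-pi/2 < \<omega> \<and> \<omega> < pi/2 \<and> l < tan \<omega> \<and> tan \<omega> < u" by (metis arctan_less_iff)
  qed
  have "emeasure (distr (density lborel (\<lambda>\<omega>. ?D \<omega> * indicator {-pi/2<..<pi/2} \<omega>)) borel tan) (box l u)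
      = (\<integral>\<^sup>+\<omega>. ?D \<omega> * indicator {-pi/2<..<pi/2} \<omega> * indicator (tan -` box l u) \<omega> \<partial>lborel)"
    by (subst emeasure_distr) (auto simp: emeasure_density measurable_sets_borel[of tan borel])
  also have "\<dots> = (\<integral>\<^sup>+\<omega>. ?D \<omega> * indicator {arctan l .. arctan u} \<omega> \<partial>lborel)"
  proof (rule nn_integral_cong_AE)
    \<comment> \<open>The box is open while the fundamental theorem is applied on a closed interval;
      the endpoints are null.\<close>
    have "AE \<omega> in lborel. \<omega> \<noteq> arctan l" "AE \<omega> in lborel. \<omega> \<noteq> arctan u"
      by (rule AE_lborel_singleton)+
    then show "AE \<omega> in lborel. ?D \<omega> * indicator {-pi/2<..<pi/2} \<omega> * indicator (tan -` box l u) \<omega>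
        = ?D \<omega> * indicator {arctan l .. arctan u} \<omega>"
    proof eventually_elim
      case (elim \<omega>)
      then show ?case
        using iff[of \<omega>] by (auto simp: indicator_def)
    qed
  qed
  also have "\<dots> = ennreal (tan (arctan u) - tan (arctan l))"
  proof (rule nn_integral_FTC_Icc)
    fix x assume "x \<in> {arctan l .. arctan u}"
    then have "cos x > 0"
      using arctan_lbound[of l] arctan_ubound[of u] by (intro cos_gt_zero_pi) auto
    then show "DERIV tan x :> 1 / (cos x)\<^sup>2"
      using DERIV_tan[of x] by (auto simp: divide_inverse)
  qed (use lu in \<open>auto simp: arctan_le_iff\<close>)
  finally show "emeasure (distr (density lborel (\<lambda>\<omega>. ?D \<omega> * indicator {-pi/2<..<pi/2} \<omega>)) borel tan) (box l u)
      = (\<Prod>b\<in>Basis. (u - l) \<bullet> b)"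
    by (simp add: tan_arctan)
qed simp

text \<open>Only one-dimensional substitutions are needed: first \<open>q = p tan \<omega>\<close>, then \<open>p = r cos \<omega>\<close>.\<close>
lemma nn_integral_half_plane_polar:
  fixes h :: "real \<times> real \<Rightarrow> ennreal"
  assumes [measurable]: "h \<in> borel_measurable borel"
  shows "(\<integral>\<^sup>+p\<in>{0<..}. \<integral>\<^sup>+q. h (p, q) \<partial>lborel \<partial>lborel)
    = (\<integral>\<^sup>+\<omega>\<in>{-pi/2<..<pi/2}. \<integral>\<^sup>+r\<in>{0<..}. ennreal r * h (r * cos \<omega>, r * sin \<omega>) \<partial>lborel \<partial>lborel)"
proof -
  have [measurable]: "h \<in> borel_measurable (borel \<Otimes>\<^sub>M borel)"
    by (simp add: borel_prod)
  have [measurable]: "(tan :: real \<Rightarrow> real) \<in> borel_measurable borel"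
    unfolding tan_def by measurable
  let ?I = "indicator {-pi/2<..<pi/2} :: real \<Rightarrow> ennreal" and ?P = "indicator {0<..} :: real \<Rightarrow> ennreal"
  have "(\<integral>\<^sup>+p. (\<integral>\<^sup>+q. h (p, q) \<partial>lborel) * ?P p \<partial>lborel)
      = (\<integral>\<^sup>+p. \<integral>\<^sup>+\<omega>. ennreal p * (ennreal (1 / (cos \<omega>)\<^sup>2) * h (p, p * tan \<omega>)) * ?P p * ?I \<omega> \<partial>lborel \<partial>lborel)"
  proof (intro nn_integral_cong)
    fix p :: real
    show "(\<integral>\<^sup>+q. h (p, q) \<partial>lborel) * ?P p
      = (\<integral>\<^sup>+\<omega>. ennreal p * (ennreal (1 / (cos \<omega>)\<^sup>2) * h (p, p * tan \<omega>)) * ?P p * ?I \<omega> \<partial>lborel)"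
    proof (cases "p > 0")
      case True
      have "(\<integral>\<^sup>+q. h (p, q) \<partial>lborel) = ennreal p * (\<integral>\<^sup>+q. h (p, p * q) \<partial>lborel)"
        using nn_integral_real_affine[of "\<lambda>q. h (p, q)" p 0] True by simp
      also have "(\<integral>\<^sup>+q. h (p, p * q) \<partial>lborel)
          = (\<integral>\<^sup>+\<omega>. ennreal (1 / (cos \<omega>)\<^sup>2) * ?I \<omega> * h (p, p * tan \<omega>) \<partial>lborel)"
        by (subst lborel_eq_distr_tan) (simp add: nn_integral_distr nn_integral_density)
      also have "ennreal p * \<dots> = (\<integral>\<^sup>+\<omega>. ennreal p * (ennreal (1 / (cos \<omega>)\<^sup>2) * ?I \<omega> * h (p, p * tan \<omega>)) \<partial>lborel)"
        by (subst nn_integral_cmult) auto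
      finally show ?thesis
        using True by (simp add: ac_simps)
    qed auto
  qed
  also have "\<dots> = (\<integral>\<^sup>+\<omega>. \<integral>\<^sup>+p. ennreal p * (ennreal (1 / (cos \<omega>)\<^sup>2) * h (p, p * tan \<omega>)) * ?P p * ?I \<omega> \<partial>lborel \<partial>lborel)"
    by (intro lborel_pair.Fubini') measurable
  also have "\<dots> = (\<integral>\<^sup>+\<omega>. (\<integral>\<^sup>+r. ennreal r * h (r * cos \<omega>, r * sin \<omega>) * ?P r \<partial>lborel) * ?I \<omega> \<partial>lborel)"
  proof (intro nn_integral_cong)
    fix \<omega> :: real
    show "(\<integral>\<^sup>+p. ennreal p * (ennreal (1 / (cos \<omega>)\<^sup>2) * h (p, p * tan \<omega>)) * ?P p * ?I \<omega> \<partial>lborel)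
      = (\<integral>\<^sup>+r. ennreal r * h (r * cos \<omega>, r * sin \<omega>) * ?P r \<partial>lborel) * ?I \<omega>"
    proof (cases "\<omega> \<in> {-pi/2<..<pi/2}")
      case True
      then have c: "cos \<omega> > 0"
        by (intro cos_gt_zero_pi) auto
      have "(\<integral>\<^sup>+p. ennreal p * (ennreal (1 / (cos \<omega>)\<^sup>2) * h (p, p * tan \<omega>)) * ?P p \<partial>lborel)
          = (\<integral>\<^sup>+r. ennreal (cos \<omega>) * (ennreal (cos \<omega> * r) * (ennreal (1 / (cos \<omega>)\<^sup>2)
              * h (cos \<omega> * r, cos \<omega> * r * tan \<omega>)) * ?P (cos \<omega> * r)) \<partial>lborel)"
        using nn_integral_real_affine[of "\<lambda>p. ennreal p * (ennreal (1 / (cos \<omega>)\<^sup>2) * h (p, p * tan \<omega>)) * ?P p" "cos \<omega>" 0] c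
        by (simp add: nn_integral_cmult)
      also have "\<dots> = (\<integral>\<^sup>+r. ennreal r * h (r * cos \<omega>, r * sin \<omega>) * ?P r \<partial>lborel)"
      proof (intro nn_integral_cong)
        fix r :: real
        \<comment> \<open>The polar Jacobian r arises as a product: \<open>cos \<omega>\<close> from
          the substitution for p, \<open>p = r cos \<omega>\<close> from scaling q by p, and the
          derivative of \<open>tan\<close>.\<close>
        have *: "ennreal (cos \<omega>) * (ennreal (cos \<omega> * r) * ennreal (1 / (cos \<omega>)\<^sup>2)) = ennreal r" if "r > 0"
          using c that by (simp add: ennreal_mult[symmetric] power2_eq_square)
        show "ennreal (cos \<omega>) * (ennreal (cos \<omega> * r) * (ennreal (1 / (cos \<omega>)\<^sup>2)
              * h (cos \<omega> * r, cos \<omega> * r * tan \<omega>)) * ?P (cos \<omega> * r)) = ennreal r * h (r * cos \<omega>, r * sin \<omega>) * ?P r"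
          using c by (cases "r > 0") (auto simp: indicator_def zero_less_mult_iff tan_def ac_simps simp flip: *)
      qed
      finally show ?thesis
        using True by simp
    qed auto
  qed
  finally show ?thesis .
qed

section \<open>Tails of the reference distributions\<close>

lemma nn_integral_powr_tail:
  fixes c s u :: real
  assumes "c \<ge> 0" "s > 0" "u > 0"
  shows "(\<integral>\<^sup>+x\<in>{u..}. ennreal (c * x powr (- s - 1)) \<partial>lborel) = ennreal (c * u powr (- s) / s)"
proof -
  have "((\<lambda>x. - c * x powr (- s) / s) \<longlongrightarrow> - c * 0 / s) at_top"
    using assms by (intro tendsto_intros tendsto_neg_powr filterlim_ident) auto
  moreover have "DERIV (\<lambda>x. - c * x powr (- s) / s) x :> c * x powr (- s - 1)" if "u \<le> x" for x
    using assms that by (auto intro!: derivative_eq_intros)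
  ultimately have "(\<integral>\<^sup>+x\<in>{u..}. ennreal (c * x powr (- s - 1)) \<partial>lborel)
      = ennreal (- c * 0 / s - - c * u powr (- s) / s)"
    using assms by (intro nn_integral_FTC_atLeast) auto
  then show ?thesis
    by simp
qed

text \<open>Power bounds on a density beyond u integrate to power bounds on its tail. The lower
  bound is stated with the correction added to f, because subtraction in \<open>ennreal\<close> is
  truncated.\<close>

lemma density_tail_bound:
  fixes f :: "real \<Rightarrow> real"
  assumes [measurable]: "f \<in> borel_measurable borel"
    and "c \<ge> 0" "d \<ge> 0" "s > 0" "s' > 0" "u > 0"
    and f_le: "\<And>x. u < x \<Longrightarrow> f x \<le> c * x powr (- s - 1)"
    and f_ge: "\<And>x. u < x \<Longrightarrow> c * x powr (- s - 1) \<le> f x + d * x powr (- s' - 1)"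
    and f_nonneg: "\<And>x. u < x \<Longrightarrow> 0 \<le> f x"
  shows "\<bar>measure (density lborel (\<lambda>x. ennreal (f x))) {u<..} - c * u powr (- s) / s\<bar> \<le> d * u powr (- s') / s'"
proof -
  have AE: "AE x in lborel. x \<noteq> u"
    by (rule AE_lborel_singleton)
  define E where "E = (\<integral>\<^sup>+x\<in>{u<..}. ennreal (f x) \<partial>lborel)"
  have E: "emeasure (density lborel (\<lambda>x. ennreal (f x))) {u<..} = E"
    by (simp add: emeasure_density E_def)
  have "E \<le> (\<integral>\<^sup>+x\<in>{u..}. ennreal (c * x powr (- s - 1)) \<partial>lborel)"
    unfolding E_def by (intro nn_integral_mono) (auto simp: indicator_def intro!: ennreal_leI f_le)
  then have le: "E \<le> ennreal (c * u powr (- s) / s)"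
    using assms by (simp add: nn_integral_powr_tail)
  \<comment> \<open>Finiteness matters because \<open>measure\<close> would be 0 on a set of
    infinite \<open>emeasure\<close>.\<close>
  then have "E < \<infinity>"
    using le_less_trans by fastforce
  define e where "e = measure (density lborel (\<lambda>x. ennreal (f x))) {u<..}"
  have e: "E = ennreal e" "e \<ge> 0"
    using \<open>E < \<infinity>\<close> E by (auto simp: e_def measure_def)
  have "ennreal (c * u powr (- s) / s) = (\<integral>\<^sup>+x\<in>{u..}. ennreal (c * x powr (- s - 1)) \<partial>lborel)"
    using assms by (simp add: nn_integral_powr_tail)
  also have "\<dots> = (\<integral>\<^sup>+x\<in>{u<..}. ennreal (c * x powr (- s - 1)) \<partial>lborel)"
    using AE by (intro nn_integral_cong_AE) (auto simp: indicator_def elim!: eventually_mono)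
  also have "\<dots> \<le> (\<integral>\<^sup>+x. ennreal (f x) * indicator {u<..} x + ennreal (d * x powr (- s' - 1)) * indicator {u..} x \<partial>lborel)"
    using f_ge f_nonneg \<open>d \<ge> 0\<close>
    by (intro nn_integral_mono) (auto simp: indicator_def ennreal_plus[symmetric] simp del: ennreal_plus intro!: ennreal_leI)
  also have "\<dots> = E + ennreal (d * u powr (- s') / s')"
    unfolding E_def using assms by (subst nn_integral_add) (auto simp: nn_integral_powr_tail)
  finally have "ennreal (c * u powr (- s) / s) \<le> ennreal (e + d * u powr (- s') / s')"
    using e assms by simp
  then have "c * u powr (- s) / s \<le> e + d * u powr (- s') / s'"
    using e assms by (subst (asm) ennreal_le_iff) auto
  moreover have "e \<le> c * u powr (- s) / s"
    using le e assms by (simp add: ennreal_le_iff)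
  moreover have "0 \<le> d * u powr (- s') / s'"
    using assms by simp
  ultimately show ?thesis
    unfolding e_def by linarith
qed

text \<open>Bernoulli's inequality for a negative exponent: apply \<open>exp z >= 1 + z\<close> at
  \<open>z = - q * ln (1 + y)\<close> and use \<open>ln (1 + y) <= y\<close>.\<close>

lemma one_plus_powr_neg_bounds:
  fixes q y :: real
  assumes "q \<ge> 0" "y \<ge> 0"
  shows "(1 + y) powr (- q) \<le> 1" "1 - q * y \<le> (1 + y) powr (- q)"
proof -
  show "(1 + y) powr (- q) \<le> 1"
    using assms powr_mono[of "- q" 0 "1 + y"] by simp
  have "1 - q * y \<le> 1 + - q * ln (1 + y)"
    using assms by (simp add: mult_left_mono ln_add_one_self_le_self)
  also have "\<dots> \<le> exp (- q * ln (1 + y))"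
    by (rule exp_ge_add_one_self)
  finally show "1 - q * y \<le> (1 + y) powr (- q)"
    using assms by (simp add: powr_def)
qed

text \<open>The tail of the reference distribution at \<open>u\<close> is \<open>tail_coeff \<alpha> m k * u powr (- \<alpha> k / 2)\<close> up to
  \<open>tail_rest m k / \<alpha> * u powr (- \<alpha> (k + 2) / 2)\<close>, and \<open>tail_rest\<close> is the constant \<open>C\<^sub>2\<close> of the error bound.\<close>
definition tail_coeff :: "nat \<Rightarrow> nat \<Rightarrow> nat \<Rightarrow> real" where
  "tail_coeff \<alpha> m k = (real k / real m) powr (real k / 2) / Beta (real m / 2) (real k / 2) * (2 / (real \<alpha> * real k))"

definition tail_rest :: "nat \<Rightarrow> nat \<Rightarrow> real" where
  "tail_rest m k = (real k * (real k + real m)) / (real m * (real k + 2)) *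
              ((real k / real m) powr (real k / 2) / Beta (real m / 2) (real k / 2))"

lemma Beta_real_pos: "a > 0 \<Longrightarrow> b > 0 \<Longrightarrow> Beta a b > (0::real)"
  by (simp add: Beta_def)

text \<open>Factoring \<open>x^2 / k\<close> out of \<open>1 + x^2 / k\<close> exhibits the density
  as a pure power times a power of \<open>1 + k / x^2\<close>, to which Bernoulli's inequality
  applies.\<close>

lemma student_tail_bound:
  fixes u :: real
  assumes "u > 0" "k > 0"
  shows "\<bar>student_tail k u - tail_coeff 2 1 k * u powr (- real k)\<bar> \<le> tail_rest 1 k / 2 * u powr (- (real k + 2))"
proof -
  define C where "C = Gamma ((real k + 1) / 2) / (sqrt (real k * pi) * Gamma (real k / 2))"
  define c where "c = C * real k powr ((real k + 1) / 2)"
  \<comment> \<open>The Bernoulli exponent (k + 1) / 2 times the k of \<open>k / x^2\<close>.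
    Integration divides by k + 2, which yields \<open>tail_rest 1 k / 2\<close>.\<close>
  define d where "d = c * ((real k + 1) / 2 * real k)"
  have C: "C = 1 / (sqrt (real k) * Beta (1/2) (real k / 2))"
    by (simp add: C_def Beta_def Gamma_one_half_real real_sqrt_mult field_simps)
  have B: "Beta (1/2) (real k / 2) > 0"
    using assms by (intro Beta_real_pos) auto
  have pos: "C \<ge> 0" "c \<ge> 0" "d \<ge> 0"
    using B by (auto simp: C c_def d_def)
  have kk: "real k powr ((real k + 1) / 2) = sqrt (real k) * real k powr (real k / 2)"
    using assms by (simp add: add_divide_distrib powr_add powr_half_sqrt)
  have c: "c = real k powr (real k / 2) / Beta (1/2) (real k / 2)"
    using assms by (simp add: c_def C kk)
  have eq: "student_density k x = c * x powr (- real k - 1) * (1 + real k / x\<^sup>2) powr (- ((real k + 1) / 2))"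
    if "x > 0" for x
  proof -
    have "1 + x\<^sup>2 / real k = (x\<^sup>2 / real k) * (1 + real k / x\<^sup>2)"
      using assms that by (simp add: field_simps)
    then have "(1 + x\<^sup>2 / real k) powr (- ((real k + 1) / 2))
        = (x\<^sup>2 / real k) powr (- ((real k + 1) / 2)) * (1 + real k / x\<^sup>2) powr (- ((real k + 1) / 2))"
      using powr_mult[of "x\<^sup>2 / real k" "1 + real k / x\<^sup>2"] by simp
    also have "(x\<^sup>2 / real k) powr (- ((real k + 1) / 2))
        = (x powr 2) powr (- ((real k + 1) / 2)) / real k powr (- ((real k + 1) / 2))"
      using assms that by (simp add: powr_divide)
    also have "\<dots> = x powr (- real k - 1) * real k powr ((real k + 1) / 2)"
    proof -
      have "2 * - ((real k + 1) / 2) = - real k - 1"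
        by (simp add: field_simps)
      then show ?thesis
        by (simp only: powr_powr) (simp add: powr_minus_divide)
    qed
    finally show ?thesis
      unfolding student_density_def c_def C_def minus_divide_left by simp
  qed
  have "\<bar>student_tail k u - c * u powr (- real k) / real k\<bar> \<le> d * u powr (- (real k + 2)) / (real k + 2)"
    unfolding student_tail_def
  proof (rule density_tail_bound)
    show "student_density k \<in> borel_measurable borel"
      unfolding student_density_def[abs_def] by measurable
    fix x assume "u < x"
    then have x: "x > 0" using assms by simp
    note b = one_plus_powr_neg_bounds[of "(real k + 1) / 2" "real k / x\<^sup>2"]
    show "student_density k x \<le> c * x powr (- real k - 1)"
      using b(1) pos x by (simp add: eq mult_left_le)
    show "0 \<le> student_density k x"
      using pos x by (simp add: eq)
    have "c * x powr (- real k - 1) * (1 - (real k + 1) / 2 * (real k / x\<^sup>2)) \<le> student_density k x"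
      unfolding eq[OF x] using pos x by (intro mult_left_mono b(2)) auto
    moreover have "x powr (- (real k + 2) - 1) = x powr (- real k - 1) / x\<^sup>2"
      using x powr_diff[of x "- real k - 1" 2] by (simp add: algebra_simps)
    ultimately show "c * x powr (- real k - 1) \<le> student_density k x + d * x powr (- (real k + 2) - 1)"
      by (simp add: d_def algebra_simps)
  qed (use pos assms in auto)
  moreover have "c * U / real k = tail_coeff 2 1 k * U" for U
    by (simp add: c tail_coeff_def)
  moreover have "d * U / (real k + 2) = tail_rest 1 k / 2 * U" for U
    by (simp add: c d_def tail_rest_def mult_ac)
  ultimately show ?thesis
    by simp
qed

text \<open>With \<open>m / k * x\<close> factored out of the last factor of the density, the
  m-dependent exponents of x cancel: m/2 - 1 - (m + k)/2 = - k/2 - 1. What remains is a power of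
  \<open>1 + k / (m * x)\<close>.\<close>

lemma F_tail_bound:
  fixes u :: real
  assumes "u > 0" "m > 0" "k > 0"
  shows "\<bar>F_tail m k u - tail_coeff 1 m k * u powr (- (real k / 2))\<bar> \<le> tail_rest m k * u powr (- ((real k + 2) / 2))"
proof -
  define B where "B = Beta (real m / 2) (real k / 2)"
  have B: "B > 0"
    unfolding B_def using assms by (intro Beta_real_pos) auto
  define c where "c = (real k / real m) powr (real k / 2) / B"
  \<comment> \<open>Bernoulli exponent times the coefficient of 1/x; dividing by k/2 + 1 in the
    integration gives exactly \<open>tail_rest m k\<close>.\<close>
  define d where "d = c * ((real m + real k) / 2 * (real k / real m))"
  have pos: "c \<ge> 0" "d \<ge> 0"
    using B by (auto simp: c_def d_def)
  have eq: "F_density m k x = c * x powr (- (real k / 2) - 1) * (1 + real k / real m / x) powr (- ((real m + real k) / 2))"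
    if "x > 0" for x
  proof -
    define y where "y = real m / real k"
    have y: "y > 0" "real k / real m = 1 / y" using assms by (auto simp: y_def)
    have "1 + y * x = (y * x) * (1 + real k / real m / x)"
      unfolding y(2) using y(1) that by (simp add: field_simps)
    then have "(1 + y * x) powr (- ((real m + real k) / 2))
        = (y * x) powr (- ((real m + real k) / 2)) * (1 + real k / real m / x) powr (- ((real m + real k) / 2))"
      using y(1) that by (metis powr_mult)
    also have "(y * x) powr (- ((real m + real k) / 2))
        = y powr (- ((real m + real k) / 2)) * x powr (- ((real m + real k) / 2))"
      using y that by (simp add: powr_mult)
    moreover have "F_density m k x = y powr (real m / 2) * x powr (real m / 2 - 1) * (1 + y * x) powr (- ((real m + real k) / 2)) / B"
      unfolding F_density_def y_def B_def minus_divide_left using that by simp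
    ultimately have "F_density m k x = (y powr (real m / 2) * y powr (- ((real m + real k) / 2)))
        * (x powr (real m / 2 - 1) * x powr (- ((real m + real k) / 2)))
        * (1 + real k / real m / x) powr (- ((real m + real k) / 2)) / B"
      by simp
    also have "y powr (real m / 2) * y powr (- ((real m + real k) / 2)) = (real k / real m) powr (real k / 2)"
      using y by (simp add: powr_add[symmetric] powr_divide powr_minus_divide[symmetric] add_divide_distrib)
    also have "x powr (real m / 2 - 1) * x powr (- ((real m + real k) / 2)) = x powr (- (real k / 2) - 1)"
      unfolding powr_add[symmetric] by (rule arg_cong) (simp add: add_divide_distrib)
    finally show ?thesis
      by (simp add: c_def)
  qed
  have "\<bar>F_tail m k u - c * u powr (- (real k / 2)) / (real k / 2)\<bar> \<le> d * u powr (- (real k / 2 + 1)) / (real k / 2 + 1)"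
    unfolding F_tail_def
  proof (rule density_tail_bound)
    show "F_density m k \<in> borel_measurable borel"
      unfolding F_density_def[abs_def] by measurable
    fix x assume "u < x"
    then have x: "x > 0" using assms by simp
    note b = one_plus_powr_neg_bounds[of "(real m + real k) / 2" "real k / real m / x"]
    show "F_density m k x \<le> c * x powr (- (real k / 2) - 1)"
      using b(1) pos x by (simp add: eq mult_left_le)
    show "0 \<le> F_density m k x"
      using pos x by (simp add: eq)
    have "c * x powr (- (real k / 2) - 1) * (1 - (real m + real k) / 2 * (real k / real m / x)) \<le> F_density m k x"
      unfolding eq[OF x] using pos x by (intro mult_left_mono b(2)) auto
    moreover have "x powr (- (real k / 2 + 1) - 1) = x powr (- (real k / 2) - 1) / x"
    proof -
      have "- (real k / 2 + 1) - 1 = (- (real k / 2) - 1) - 1"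
        by simp
      then show ?thesis
        using x by (simp only: powr_diff) simp
    qed
    moreover have "c * Z * (1 - (real m + real k) / 2 * (real k / real m / x)) = c * Z - d * (Z / x)" for Z
      by (simp add: d_def right_diff_distrib mult_ac)
    ultimately show "c * x powr (- (real k / 2) - 1) \<le> F_density m k x + d * x powr (- (real k / 2 + 1) - 1)"
      by simp
  qed (use pos assms in auto)
  moreover have "c * U / (real k / 2) = tail_coeff 1 m k * U" for U
    by (simp add: c_def B_def tail_coeff_def)
  moreover have "d * U / (real k / 2 + 1) = tail_rest m k * U" for U
  proof -
    have "real k / 2 + 1 = (real k + 2) / 2"
      by simp
    then show ?thesis
      by (simp add: c_def d_def B_def tail_rest_def mult_ac add.commute)
  qed
  moreover have "- (real k / 2) - 1 = - ((real k + 2) / 2)"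
    by (simp add: field_simps)
  ultimately show ?thesis
    by simp
qed

section \<open>Comparison with a multiple of the reference tail\<close>

text \<open>As \<open>gradient\<close> is a definite description, a representing vector has to be
  both constructed, from the values of the derivative on the basis, and shown unique.\<close>

lemma has_derivative_gradient:
  fixes f :: "'b::euclidean_space \<Rightarrow> real"
  assumes "f differentiable (at x)"
  shows "(f has_derivative (\<lambda>h. h \<bullet> gradient f x)) (at x)"
proof -
  obtain f' where f': "(f has_derivative f') (at x)"
    using assms by (auto simp: differentiable_def)
  then have lin: "linear f'"
    by (rule has_derivative_linear)
  define D where "D = (\<Sum>b\<in>Basis. f' b *\<^sub>R b)"
  have "f' h = h \<bullet> D" for h
  proof -
    have "f' h = f' (\<Sum>b\<in>Basis. (h \<bullet> b) *\<^sub>R b)"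
      by (simp add: euclidean_representation)
    also have "\<dots> = h \<bullet> D"
      using lin by (simp add: linear_sum linear_cmul D_def inner_sum_right mult.commute)
    finally show ?thesis .
  qed
  then have "f' = (\<lambda>h. h \<bullet> D)"
    by blast
  then have D: "GDERIV f x :> D"
    using f' by (simp add: gderiv_def)
  have "E = D" if "GDERIV f x :> E" for E
  proof -
    have "(\<lambda>h. h \<bullet> E) = (\<lambda>h. h \<bullet> D)"
      using D that unfolding gderiv_def by (rule has_derivative_unique[rotated])
    then have "(E - D) \<bullet> (E - D) = 0"
      by (metis inner_diff_right right_minus_eq)
    then show ?thesis
      by simp
  qed
  with D have "GDERIV f x :> gradient f x"
    unfolding gradient_def by (rule theI)
  then show ?thesis
    by (simp add: gderiv_def)
qed

text \<open>A finite bound on \<open>gradient_norm\<close> carries differentiability with it, so the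
  mean value inequality applies on the convex closed ball, between x and 0.\<close>

lemma gradient_norm_bound:
  fixes G :: "'b::euclidean_space \<Rightarrow> ennreal"
  assumes s: "\<And>x. norm x \<le> \<rho> \<Longrightarrow> gradient_norm G x \<le> ennreal s" and "s \<ge> 0" and x: "norm x \<le> \<rho>"
  shows "G x = ennreal (enn2real (G x))" "\<bar>enn2real (G x) - enn2real (G 0)\<bar> \<le> s * \<rho>"
proof -
  define f where "f = (\<lambda>y. enn2real (G y))"
  have G: "differentiable_at_point G y" "norm (gradient f y) \<le> s" if "norm y \<le> \<rho>" for y
  proof -
    \<comment> \<open>Otherwise \<open>gradient_norm G y\<close> would be infinite and exceed
      s.\<close>
    show "differentiable_at_point G y"
      using s[OF that] by (rule contrapos_pp) (simp add: gradient_norm_def top_unique)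
    then show "norm (gradient f y) \<le> s"
      using s[OF that] \<open>s \<ge> 0\<close> by (simp add: gradient_norm_def f_def)
  qed
  have "\<forall>\<^sub>F y in nhds x. G y < \<infinity>"
    using G(1)[OF x] by (simp add: differentiable_at_point_def)
  then have "G x < \<infinity>"
    by (rule eventually_nhds_x_imp_x)
  then show "G x = ennreal (enn2real (G x))"
    by simp
  have "0 \<le> \<rho>"
    using x norm_ge_zero[of x] by linarith
  have "norm (f x - f 0) \<le> s * norm (x - 0)"
  proof (rule differentiable_bound)
    fix y :: 'b assume "y \<in> cball 0 \<rho>"
    then have y: "norm y \<le> \<rho>" by simp
    show "(f has_derivative (\<lambda>h. h \<bullet> gradient f y)) (at y within cball 0 \<rho>)"
      using G(1)[OF y] by (intro has_derivative_at_withinI[OF has_derivative_gradient]) (simp add: differentiable_at_point_def f_def)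
    show "onorm (\<lambda>h. h \<bullet> gradient f y) \<le> s"
    proof (rule onorm_bound)
      fix h
      have "norm (h \<bullet> gradient f y) \<le> norm h * norm (gradient f y)"
        using Cauchy_Schwarz_ineq2 by simp
      also have "\<dots> \<le> s * norm h"
        using mult_right_mono[OF G(2)[OF y] norm_ge_zero[of h]] by (simp add: mult.commute)
      finally show "norm (h \<bullet> gradient f y) \<le> s * norm h" .
    qed fact
  qed (use x \<open>0 \<le> \<rho>\<close> in auto)
  also have "\<dots> \<le> s * \<rho>"
    using x \<open>s \<ge> 0\<close> by (simp add: mult_left_mono)
  finally show "\<bar>enn2real (G x) - enn2real (G 0)\<bar> \<le> s * \<rho>"
    by (simp add: f_def)
qed

text \<open>On the ball, \<open>G\<close> deviates from \<open>G 0\<close> by at most s times the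
  radius; multiplying by the volume raises the power of the radius to the dimension plus one and
  makes the unit ball volume the constant \<open>C1\<close>.\<close>

lemma ball_integral_approx:
  fixes G :: "'b::euclidean_space \<Rightarrow> ennreal"
  assumes s: "\<And>x. norm x \<le> \<rho> \<Longrightarrow> gradient_norm G x \<le> ennreal s" and "s \<ge> 0" "\<rho> > 0" "p \<ge> 0"
    and p: "ennreal p = (\<integral>\<^sup>+t\<in>ball 0 \<rho>. G t \<partial>lborel)"
  shows "\<bar>p - unit_ball_vol DIM('b) * \<rho> ^ DIM('b) * enn2real (G 0)\<bar>
    \<le> unit_ball_vol DIM('b) * s * \<rho> ^ (DIM('b) + 1)"
proof -
  note b = gradient_norm_bound[where \<rho> = \<rho>, OF s \<open>s \<ge> 0\<close>]
  define g0 where "g0 = enn2real (G 0)"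
  define v where "v = unit_ball_vol DIM('b) * \<rho> ^ DIM('b)"
  have g0: "g0 \<ge> 0" and v: "v \<ge> 0"
    using \<open>\<rho> > 0\<close> by (auto simp: g0_def v_def)
  have const: "(\<integral>\<^sup>+t\<in>ball (0::'b) \<rho>. ennreal c \<partial>lborel) = ennreal (v * c)" if "c \<ge> 0" for c
    using \<open>\<rho> > 0\<close> that v by (simp add: nn_integral_cmult_indicator emeasure_ball v_def ennreal_mult[symmetric] mult.commute)
  have "ennreal p \<le> (\<integral>\<^sup>+t\<in>ball (0::'b) \<rho>. ennreal (g0 + s * \<rho>) \<partial>lborel)"
    unfolding p
  proof (rule nn_integral_mono)
    fix x :: 'b
    have "G x \<le> ennreal (g0 + s * \<rho>)" if "norm x < \<rho>"
    proof -
      have "ennreal (enn2real (G x)) \<le> ennreal (g0 + s * \<rho>)"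
        using b(2)[of x] that unfolding g0_def by (intro ennreal_leI) linarith
      then show ?thesis
        using b(1)[of x] that by simp
    qed
    then show "G x * indicator (ball 0 \<rho>) x \<le> ennreal (g0 + s * \<rho>) * indicator (ball 0 \<rho>) x"
      by (auto simp: indicator_def)
  qed
  then have 1: "p \<le> v * (g0 + s * \<rho>)"
    using g0 v \<open>s \<ge> 0\<close> \<open>\<rho> > 0\<close> by (subst (asm) const) (auto simp: ennreal_le_iff)
  \<comment> \<open>The lower bound may be negative; \<open>max 0\<close> brings it within reach of
    \<open>const\<close>, which is stated for non-negative constants.\<close>
  have "(\<integral>\<^sup>+t\<in>ball (0::'b) \<rho>. ennreal (max 0 (g0 - s * \<rho>)) \<partial>lborel) \<le> ennreal p"
    unfolding p
  proof (rule nn_integral_mono)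
    fix x :: 'b
    have "ennreal (max 0 (g0 - s * \<rho>)) \<le> G x" if "norm x < \<rho>"
    proof -
      have "max 0 (g0 - s * \<rho>) \<le> enn2real (G x)"
        using b(2)[of x] that enn2real_nonneg[of "G x"] unfolding g0_def by linarith
      then show ?thesis
        using b(1)[of x] that by (metis ennreal_leI less_imp_le)
    qed
    then show "ennreal (max 0 (g0 - s * \<rho>)) * indicator (ball 0 \<rho>) x \<le> G x * indicator (ball 0 \<rho>) x"
      by (auto simp: indicator_def)
  qed
  then have "v * max 0 (g0 - s * \<rho>) \<le> p"
    using \<open>p \<ge> 0\<close> by (subst (asm) const) (auto simp: ennreal_le_iff)
  moreover have "v * (g0 - s * \<rho>) \<le> v * max 0 (g0 - s * \<rho>)"
    using v by (intro mult_left_mono) auto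
  ultimately have "\<bar>p - v * g0\<bar> \<le> v * (s * \<rho>)"
    using 1 by (auto simp: algebra_simps abs_le_iff)
  then show ?thesis
    by (simp add: v_def g0_def algebra_simps)
qed

text \<open>The final step shared by the three settings: p and \<open>K * tl\<close> are both close
  to the unit ball volume times \<rho>^k times \<open>G 0\<close>, where hypothesis \<open>K\<close>
  matches the leading terms, and the triangle inequality concludes.\<close>

lemma tail_error_bound:
  fixes G :: "'b::euclidean_space \<Rightarrow> ennreal" and u p tl K :: real
  assumes "u > 0" "\<alpha> > 0" "p \<ge> 0" "K \<ge> 0" and k: "DIM('b) = k"
    and p: "ennreal p = (\<integral>\<^sup>+t\<in>ball 0 (u powr (- real \<alpha> / 2)). G t \<partial>lborel)"
    and K: "K * tail_coeff \<alpha> m k = unit_ball_vol k * enn2real (G 0)"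
    and tl: "\<bar>tl - tail_coeff \<alpha> m k * u powr (- (real \<alpha> * real k / 2))\<bar>
      \<le> tail_rest m k / real \<alpha> * u powr (- (real \<alpha> * (real k + 2) / 2))"
  shows "ennreal \<bar>p - K * tl\<bar> \<le> tail_error \<alpha> m k K G u"
proof -
  define \<rho> where "\<rho> = u powr (- real \<alpha> / 2)"
  define S where "S = (SUP x\<in>{x. norm x \<le> \<rho>}. gradient_norm G x)"
  define e where "e = 1 / u powr (real \<alpha> * (real k + 1) / 2)"
  have e: "e > 0" and \<rho>: "\<rho> > 0"
    using \<open>u > 0\<close> by (auto simp: e_def \<rho>_def)
  have v: "unit_ball_vol k \<noteq> 0"
    by (metis unit_ball_vol_pos of_nat_0_le_iff less_irrefl)
  have err: "tail_error \<alpha> m k K G u = ennreal e * (ennreal (unit_ball_vol k) * S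
      + ennreal (tail_rest m k * (K / real \<alpha>) * (1 / u powr (real \<alpha> / 2))))"
    unfolding tail_error_def Let_def e_def S_def \<rho>_def tail_rest_def by (rule refl)
  show ?thesis
  proof (cases "S = \<infinity>")
    \<comment> \<open>The supremum has the positive coefficients e and
      \<open>unit_ball_vol k\<close>, so the whole bound is infinite.\<close>
    case True
    then show ?thesis
      using e v by (simp add: err ennreal_mult_top ennreal_mult_eq_top_iff)
  next
    case False
    then obtain s where s: "S = ennreal s" "s \<ge> 0"
      by (cases S) auto
    have "gradient_norm G x \<le> ennreal s" if "norm x \<le> \<rho>" for x
      unfolding s(1)[symmetric] S_def using that by (intro SUP_upper) auto
    from ball_integral_approx[OF this \<open>s \<ge> 0\<close> \<rho> \<open>p \<ge> 0\<close>]
    have 1: "\<bar>p - unit_ball_vol k * \<rho> ^ k * enn2real (G 0)\<bar> \<le> unit_ball_vol k * s * \<rho> ^ (k + 1)"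
      using p by (simp add: \<rho>_def k)
    have pow: "\<rho> ^ j = u powr (- (real \<alpha> * real j / 2))" for j
      using \<rho> \<open>u > 0\<close> by (simp add: powr_realpow[symmetric] \<rho>_def powr_powr)
    \<comment> \<open>The prefactor of the error bound is one power of \<rho> more than the ball
      volume; the remainder of the reference tail carries another factor
      \<open>u powr (- \<alpha> / 2)\<close>, displayed separately in the bracket.\<close>
    have pow1: "\<rho> ^ (k + 1) = e"
      unfolding pow e_def by (simp add: powr_minus_divide add.commute)
    have ex: "real \<alpha> * (real k + 2) / 2 = real \<alpha> * (real k + 1) / 2 + real \<alpha> / 2"
      by (simp add: field_simps)
    have "u powr (- (real \<alpha> * (real k + 2) / 2)) = e * (1 / u powr (real \<alpha> / 2))"
      unfolding ex e_def powr_minus_divide powr_add by simp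
    then have "K * \<bar>tl - tail_coeff \<alpha> m k * \<rho> ^ k\<bar> \<le> K * (tail_rest m k / real \<alpha> * (e * (1 / u powr (real \<alpha> / 2))))"
      using tl \<open>K \<ge> 0\<close> by (intro mult_left_mono) (auto simp: pow)
    moreover have "K * \<bar>tl - tail_coeff \<alpha> m k * \<rho> ^ k\<bar> = \<bar>K * tl - K * tail_coeff \<alpha> m k * \<rho> ^ k\<bar>"
    proof -
      have "K * \<bar>tl - tail_coeff \<alpha> m k * \<rho> ^ k\<bar> = \<bar>K * (tl - tail_coeff \<alpha> m k * \<rho> ^ k)\<bar>"
        using \<open>K \<ge> 0\<close> by (simp add: abs_mult)
      then show ?thesis
        by (simp add: right_diff_distrib mult.assoc)
    qed
    moreover have Kc: "K * tail_coeff \<alpha> m k * \<rho> ^ k = unit_ball_vol k * \<rho> ^ k * enn2real (G 0)"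
      by (simp add: K)
    ultimately have 2: "\<bar>K * tl - unit_ball_vol k * \<rho> ^ k * enn2real (G 0)\<bar>
        \<le> K * (tail_rest m k / real \<alpha> * (e * (1 / u powr (real \<alpha> / 2))))"
      by (simp only: Kc)
    \<comment> \<open>Positivity of \<open>Beta\<close> takes positive arguments; in the degenerate
      cases the first quotient is 0, for m = 0 because x / 0 = 0.\<close>
    have rest: "tail_rest m k \<ge> 0"
    proof (cases "m = 0 \<or> k = 0")
      case False
      then have "Beta (real m / 2) (real k / 2) > 0"
        by (intro Beta_real_pos) auto
      then show ?thesis
        by (simp add: tail_rest_def)
    qed (auto simp: tail_rest_def)
    have "\<bar>p - K * tl\<bar> \<le> e * (unit_ball_vol k * s + tail_rest m k * (K / real \<alpha>) * (1 / u powr (real \<alpha> / 2)))"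
    proof -
      have "\<bar>p - K * tl\<bar> \<le> unit_ball_vol k * s * e + K * (tail_rest m k / real \<alpha> * (e * (1 / u powr (real \<alpha> / 2))))"
        using 1 2 unfolding pow1 by linarith
      also have "\<dots> = e * (unit_ball_vol k * s + tail_rest m k * (K / real \<alpha>) * (1 / u powr (real \<alpha> / 2)))"
        by (simp add: distrib_left)
      finally show ?thesis .
    qed
    then have "ennreal \<bar>p - K * tl\<bar> \<le> ennreal (e * (unit_ball_vol k * s + tail_rest m k * (K / real \<alpha>) * (1 / u powr (real \<alpha> / 2))))"
      by (rule ennreal_leI)
    also have "\<dots> = tail_error \<alpha> m k K G u"
      using e v s \<open>K \<ge> 0\<close> rest unfolding err by (simp add: ennreal_mult'' ennreal_plus ennreal_mult)
    finally show ?thesis .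
  qed
qed

section \<open>Coordinates adapted to the sample statistics\<close>

text \<open>Orthogonality to the diagonal says that the coordinates of z sum to 0, so only the
  diagonal part has a mean.\<close>

lemma sample_mean_orthogonal:
  fixes z :: "real ^ 'i"
  assumes "unit_diag \<bullet> z = 0"
  shows "sample_mean (r *\<^sub>R unit_diag + z) = r / sqrt (real CARD('i))"
proof -
  have "(\<Sum>i\<in>UNIV. z $ i) / sqrt (real CARD('i)) = 0"
    using assms by (simp add: unit_diag_def inner_vec_def sum_divide_distrib)
  then have "(\<Sum>i\<in>UNIV. z $ i) = 0"
    by simp
  then show ?thesis
    by (simp add: sample_mean_def unit_diag_def sum.distrib)
qed

text \<open>Subtracting the mean is the orthogonal projection off the diagonal, hence z is the
  centred sample.\<close>

lemma sample_var_orthogonal: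
  fixes z :: "real ^ 'i"
  assumes "unit_diag \<bullet> z = 0"
  shows "sample_var (r *\<^sub>R unit_diag + z) = (norm z)\<^sup>2 / (real CARD('i) - 1)"
proof -
  have "(\<Sum>i\<in>UNIV. ((r *\<^sub>R unit_diag + z) $ i - sample_mean (r *\<^sub>R unit_diag + z))\<^sup>2) = (\<Sum>i\<in>UNIV. (z $ i)\<^sup>2)"
    by (simp add: sample_mean_orthogonal[OF assms]) (simp add: unit_diag_def)
  also have "\<dots> = (norm z)\<^sup>2"
    unfolding power2_norm_eq_inner inner_vec_def by (simp add: power2_eq_square)
  finally show ?thesis
    by (simp add: sample_var_def)
qed

lemma continuous_on_sample_mean: "continuous_on UNIV (sample_mean :: real ^ 'i \<Rightarrow> real)"
  unfolding sample_mean_def[abs_def] by (intro continuous_intros) auto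

lemma borel_measurable_sample_mean [measurable]: "(sample_mean :: real ^ 'i \<Rightarrow> real) \<in> borel_measurable borel"
  by (intro borel_measurable_continuous_onI continuous_on_sample_mean)

lemma borel_measurable_sample_var [measurable]: "(sample_var :: real ^ 'i \<Rightarrow> real) \<in> borel_measurable borel"
proof (rule borel_measurable_continuous_onI)
  \<comment> \<open>Multiplication by a constant inverse avoids the side condition that the divisor
    is non-zero, which fails for a sample of size 1.\<close>
  have "continuous_on UNIV (\<lambda>x :: real ^ 'i. (\<Sum>i\<in>UNIV. (x $ i - sample_mean x)\<^sup>2) * inverse (real CARD('i) - 1))"
    by (intro continuous_intros continuous_on_sample_mean)
  then show "continuous_on UNIV (sample_var :: real ^ 'i \<Rightarrow> real)"
    by (simp add: sample_var_def[abs_def] divide_inverse)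
qed

lemma borel_measurable_sample_sd [measurable]: "(sample_sd :: real ^ 'i \<Rightarrow> real) \<in> borel_measurable borel"
  unfolding sample_sd_def[abs_def] by measurable

lemma sample_sd_nonneg: "sample_sd (x :: real ^ 'i) \<ge> 0"
proof -
  have "real CARD('i) \<ge> 1"
    by (simp add: Suc_leI)
  then show ?thesis
    by (simp add: sample_sd_def sample_var_def sum_nonneg)
qed

lemma prob_gt_eq_nn_integral:
  assumes "has_continuous_density M X g" and [measurable]: "T \<in> borel_measurable borel"
  shows "ennreal (measure M {s \<in> space M. T (X s) > u}) = (\<integral>\<^sup>+x. ennreal (g x) * indicator {x. T x > (u::real)} x \<partial>lborel)"
proof -
  interpret prob_space M
    using assms by (simp add: has_continuous_density_def)
  have D: "distributed M lborel X (\<lambda>x. ennreal (g x))"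
    using assms by (simp add: has_continuous_density_def)
  have "{s \<in> space M. T (X s) > u} = X -` {x. T x > u} \<inter> space M"
    by auto
  then show ?thesis
    using distributed_emeasure[OF D, of "{x. T x > u}"] by (simp add: emeasure_eq_measure)
qed

lemma has_continuous_densityD:
  assumes "has_continuous_density M X g"
  shows "g \<in> borel_measurable borel" "g x \<ge> 0"
  using assms by (auto simp: has_continuous_density_def intro: borel_measurable_continuous_onI)

section \<open>Orthonormal coordinates along and across the diagonal\<close>

lemma sum_UNIV_option: "(\<Sum>i\<in>UNIV. f i) = f None + (\<Sum>j\<in>UNIV. f (Some j))" for f :: "'k::finite option \<Rightarrow> real"
  by (simp add: UNIV_option_conv sum.reindex)

lemma linear_append_zero: "linear (append_zero :: real ^ 'k \<Rightarrow> real ^ ('k::finite option))"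
  by (rule linearI) (auto simp: append_zero_def vec_eq_iff split: option.split)

lemma borel_measurable_append_zero [measurable]: "append_zero \<in> borel_measurable borel"
  by (intro borel_measurable_linear linear_append_zero)

lemma norm_append_zero: "norm (append_zero t) = norm t"
  by (simp add: norm_eq_sqrt_inner inner_vec_def sum_UNIV_option append_zero_def)

lemma axis_inner_append_zero: "axis None 1 \<bullet> append_zero t = 0"
  by (simp add: inner_axis' append_zero_def)

lemma one_sample_rotation_linear:
  assumes "one_sample_rotation A"
  shows "linear (\<lambda>t. A (append_zero t))"
  using assms linear_compose[OF linear_append_zero, of A]
  by (auto simp: one_sample_rotation_def orthogonal_transformation_linear comp_def)

lemma one_sample_rotation_props:
  fixes A :: "real ^ ('k::finite option) \<Rightarrow> real ^ ('k option)"
  assumes "one_sample_rotation A"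
  shows "unit_diag \<bullet> A (append_zero t) = 0" "norm (A (append_zero t)) = norm t" "norm (unit_diag :: real ^ ('k option)) = 1"
proof -
  have A: "orthogonal_transformation A" and d: "unit_diag = A (axis None 1)"
    using assms by (auto simp: one_sample_rotation_def)
  show "unit_diag \<bullet> A (append_zero t) = 0"
    unfolding d using A by (simp add: orthogonal_transformation_def axis_inner_append_zero)
  show "norm (A (append_zero t)) = norm t"
    using A by (simp add: orthogonal_transformation norm_append_zero)
  show "norm (unit_diag :: real ^ ('k option)) = 1"
    by (simp add: norm_eq_sqrt_inner inner_vec_def unit_diag_def)
qed

text \<open>Since A sends the last axis to the diagonal, it sends vectors ending in 0 to the
  orthogonal complement, and Pythagoras makes the parametrisation an isometry.\<close>

lemma nn_integral_one_sample_rotation: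
  fixes A :: "real ^ ('k::finite option) \<Rightarrow> real ^ ('k option)"
  assumes A: "one_sample_rotation A" and [measurable]: "h \<in> borel_measurable borel"
  shows "(\<integral>\<^sup>+y. h y \<partial>lborel) = (\<integral>\<^sup>+r. \<integral>\<^sup>+t. h (r *\<^sub>R unit_diag + A (append_zero t)) \<partial>lborel \<partial>lborel)"
proof -
  note P = one_sample_rotation_props[OF A]
  interpret linear "\<lambda>t. A (append_zero t)"
    by (rule one_sample_rotation_linear[OF A])
  define f where "f = (\<lambda>(r, t). r *\<^sub>R unit_diag + A (append_zero t))"
  have "linear f"
    by (rule linearI) (auto simp: f_def add scale algebra_simps)
  moreover have "norm (f x) = norm x" for x
  proof -
    obtain r t where x: "x = (r, t)" by (cases x)
    have "(norm (f x))\<^sup>2 = r\<^sup>2 + (norm t)\<^sup>2"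
      using P by (simp add: x f_def orthogonal_def norm_add_Pythagorean power_mult_distrib)
    then show ?thesis
      by (simp add: x norm_Pair real_sqrt_unique)
  qed
  ultimately show ?thesis
    using nn_integral_isometry_pair[of f h] by (simp add: f_def)
qed

lemma less_inverse_norm_iff:
  assumes "u > 0" "t \<noteq> 0"
  shows "u < 1 / norm t \<longleftrightarrow> t \<in> ball 0 (1 / u)"
  using assms by (simp add: field_simps)

lemma power_sqrt: "x > 0 \<Longrightarrow> sqrt x ^ n = x powr (real n / 2)"
  using powr_powr[of x "1 / 2" "real n"] by (simp add: powr_half_sqrt powr_realpow)

section \<open>The one-sample statistic\<close>

text \<open>With k = n - 1 and r > 0 fixed, the complement is rescaled by \<open>r * sqrt k\<close>.
  The Jacobian of this scaling is \<open>k powr (k / 2) * r ^ k\<close>, which is the prefactor of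
  \<open>G\<close> together with its weight.\<close>

lemma one_sample_prob:
  fixes A :: "real ^ ('k::finite option) \<Rightarrow> real ^ ('k option)"
  assumes X: "has_continuous_density M X g" and A: "one_sample_rotation A" and u: "u > 0"
  shows "ennreal (measure M {s \<in> space M. one_sample_T (X s) > u}) = (\<integral>\<^sup>+t\<in>ball 0 (1 / u). one_sample_G A g t \<partial>lborel)"
proof -
  note [measurable] = has_continuous_densityD(1)[OF X]
  note P = one_sample_rotation_props[OF A]
  interpret A: linear "\<lambda>t. A (append_zero t)"
    by (rule one_sample_rotation_linear[OF A])
  have [measurable]: "A \<in> borel_measurable borel"
    using A by (auto simp: one_sample_rotation_def intro!: borel_measurable_linear orthogonal_transformation_linear)
  have ball [measurable]: "ball (0 :: real ^ 'k) r \<in> sets borel" for r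
    by simp
  define k where "k = CARD('k)"
  have k: "k > 0" "CARD('k option) = Suc k"
    by (simp_all add: k_def)
  have [measurable]: "(one_sample_T :: real ^ ('k option) \<Rightarrow> real) \<in> borel_measurable borel"
    unfolding one_sample_T_def[abs_def] by measurable
  define h where "h x = ennreal (g x) * indicator {x. one_sample_T x > u} x" for x
  have [measurable]: "h \<in> borel_measurable borel"
    unfolding h_def by measurable
  define H where "H r t = ennreal (r ^ k * g (r *\<^sub>R (unit_diag + A (one_sample_v t)))) * indicator {0<..} r" for r t
  have v: "A (one_sample_v t) = sqrt k *\<^sub>R A (append_zero t)" for t
    unfolding one_sample_v_def k(2) by (simp add: A.scale[symmetric] linear_cmul[OF orthogonal_transformation_linear] A[unfolded one_sample_rotation_def])
  \<comment> \<open>The factor \<open>sqrt k\<close> cancels the divisor of the variance: the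
    standard deviation is r times the norm of t, and \<open>sqrt n\<close> times the mean is
    r.\<close>
  have T: "one_sample_T (r *\<^sub>R (unit_diag + A (one_sample_v t))) = 1 / norm t" if "r > 0" for r t
  proof -
    have "r *\<^sub>R (unit_diag + A (one_sample_v t)) = r *\<^sub>R unit_diag + (r * sqrt k) *\<^sub>R A (append_zero t)"
      by (simp add: v algebra_simps)
    then show ?thesis
      using that k P by (simp add: one_sample_T_def sample_sd_def sample_mean_orthogonal sample_var_orthogonal
          power_mult_distrib real_sqrt_mult real_sqrt_divide)
  qed
  have "(\<integral>\<^sup>+t. h (r *\<^sub>R unit_diag + A (append_zero t)) \<partial>lborel)
      = (\<integral>\<^sup>+t. ennreal (real k powr (real k / 2)) * (H r t * indicator (ball 0 (1 / u)) t) \<partial>lborel)" for r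
  proof (cases "r > 0")
    case True
    have "(\<integral>\<^sup>+t. h (r *\<^sub>R unit_diag + A (append_zero t)) \<partial>lborel)
        = ennreal ((r * sqrt k) ^ k) * (\<integral>\<^sup>+t. h (r *\<^sub>R unit_diag + A (append_zero ((r * sqrt k) *\<^sub>R t))) \<partial>lborel)"
      using True k by (subst nn_integral_lborel_scale[where c = "r * sqrt k"]) (auto simp: k_def)
    also have "\<dots> = (\<integral>\<^sup>+t. ennreal ((r * sqrt k) ^ k) * h (r *\<^sub>R (unit_diag + A (one_sample_v t))) \<partial>lborel)"
      unfolding v by (subst nn_integral_cmult) (auto simp: A.scale algebra_simps)
    also have "\<dots> = (\<integral>\<^sup>+t. ennreal (real k powr (real k / 2)) * (H r t * indicator (ball 0 (1 / u)) t) \<partial>lborel)"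
    proof (rule nn_integral_cong_AE)
      \<comment> \<open>At \<open>t = 0\<close> the statistic has the junk value \<open>r / 0 = 0\<close>.\<close>
      have "AE t in lborel. t \<noteq> (0 :: real ^ 'k)"
        by (rule AE_lborel_singleton)
      then show "AE t in lborel. ennreal ((r * sqrt k) ^ k) * h (r *\<^sub>R (unit_diag + A (one_sample_v t)))
          = ennreal (real k powr (real k / 2)) * (H r t * indicator (ball 0 (1 / u)) t)"
      proof eventually_elim
        case (elim t)
        have "indicator {x. one_sample_T x > u} (r *\<^sub>R (unit_diag + A (one_sample_v t))) = (indicator (ball 0 (1 / u)) t :: ennreal)"
          using less_inverse_norm_iff[OF u elim] T[OF True, of t] by (simp add: indicator_def)
        moreover have "(r * sqrt k) ^ k = real k powr (real k / 2) * r ^ k"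
          using k by (simp add: power_mult_distrib power_sqrt)
        ultimately show ?case
          using True has_continuous_densityD(2)[OF X]
          by (simp add: h_def H_def ennreal_mult mult_ac)
      qed
    qed
    finally show ?thesis .
  next
    case False
    \<comment> \<open>A non-positive diagonal component gives a non-positive mean, so this half-line
      does not contribute to the event.\<close>
    have "one_sample_T (r *\<^sub>R unit_diag + A (append_zero t)) \<le> 0" for t
      using False P by (simp add: one_sample_T_def sample_mean_orthogonal sample_sd_nonneg divide_le_0_iff mult_le_0_iff)
    then have "\<not> one_sample_T (r *\<^sub>R unit_diag + A (append_zero t)) > u" for t
      using u by (meson less_le_trans less_asym not_le order.strict_trans1)
    then show ?thesis
      using False by (simp add: h_def H_def)
  qed
  then have "ennreal (measure M {s \<in> space M. one_sample_T (X s) > u})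
      = (\<integral>\<^sup>+r. \<integral>\<^sup>+t. ennreal (real k powr (real k / 2)) * (H r t * indicator (ball 0 (1 / u)) t) \<partial>lborel \<partial>lborel)"
    using prob_gt_eq_nn_integral[OF X, of one_sample_T u] nn_integral_one_sample_rotation[OF A, of h]
    by (simp add: h_def[symmetric])
  also have "\<dots> = (\<integral>\<^sup>+t. \<integral>\<^sup>+r. ennreal (real k powr (real k / 2)) * (H r t * indicator (ball 0 (1 / u)) t) \<partial>lborel \<partial>lborel)"
    unfolding H_def v by (rule lborel_pair.Fubini') measurable
  also have "\<dots> = (\<integral>\<^sup>+t\<in>ball 0 (1 / u). one_sample_G A g t \<partial>lborel)"
  proof (rule nn_integral_cong)
    fix t
    have "(\<integral>\<^sup>+r. ennreal (real k powr (real k / 2)) * (H r t * indicator (ball 0 (1 / u)) t) \<partial>lborel)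
        = ennreal (real k powr (real k / 2)) * ((\<integral>\<^sup>+r. H r t \<partial>lborel) * indicator (ball 0 (1 / u)) t)"
      unfolding H_def v by (simp add: nn_integral_cmult nn_integral_multc)
    then show "(\<integral>\<^sup>+r. ennreal (real k powr (real k / 2)) * (H r t * indicator (ball 0 (1 / u)) t) \<partial>lborel)
        = one_sample_G A g t * indicator (ball 0 (1 / u)) t"
      unfolding one_sample_G_def k(2) H_def by (simp add: mult.assoc)
  qed
  finally show ?thesis .
qed

section \<open>The F-statistic\<close>

text \<open>Only the second sample is transformed, for fixed x. The scale
  \<open>sqrt k * sample_sd x\<close> does not involve r, because the variance ignores location;
  hence r runs over the whole line.\<close>

lemma F_prob:
  fixes A :: "real ^ ('k::finite option) \<Rightarrow> real ^ ('k option)" and g :: "(real ^ 'm) \<times> (real ^ ('k option)) \<Rightarrow> real"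
  assumes X: "has_continuous_density M Z g" and A: "one_sample_rotation A" and u: "u > 0"
  shows "ennreal (measure M {s \<in> space M. F_T (Z s) > u}) = (\<integral>\<^sup>+t\<in>ball 0 (1 / sqrt u). F_G A g t \<partial>lborel)"
proof -
  have g_borel: "g \<in> borel_measurable borel"
    using has_continuous_densityD(1)[OF X] .
  then have [measurable]: "g \<in> borel_measurable (borel \<Otimes>\<^sub>M borel)"
    by (simp add: borel_prod)
  note P = one_sample_rotation_props[OF A]
  interpret A: linear "\<lambda>t. A (append_zero t)"
    by (rule one_sample_rotation_linear[OF A])
  have [measurable]: "A \<in> borel_measurable borel"
    using A by (auto simp: one_sample_rotation_def intro!: borel_measurable_linear orthogonal_transformation_linear)
  have ball [measurable]: "ball (0 :: real ^ 'k) r \<in> sets borel" for r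
    by simp
  define k where "k = CARD('k)"
  have k: "k > 0" "CARD('k option) = Suc k"
    by (simp_all add: k_def)
  have FT [measurable]: "(F_T :: (real ^ 'm) \<times> (real ^ ('k option)) \<Rightarrow> real) \<in> borel_measurable (borel \<Otimes>\<^sub>M borel)"
    unfolding F_T_def[abs_def] by measurable
  define h where "h x = ennreal (g x) * indicator {x. F_T x > u} x" for x
  have [measurable]: "h \<in> borel_measurable (borel \<Otimes>\<^sub>M borel)"
    unfolding h_def by measurable
  define Y where "Y x r t = r *\<^sub>R unit_diag + (sqrt k * sample_sd x) *\<^sub>R A (append_zero t)" for x :: "real ^ 'm" and r t
  define H where "H x r t = ennreal (g (x, Y x r t))" for x r t
  let ?K = "ennreal (real k powr (real k / 2))" and ?B = "indicator (ball 0 (1 / sqrt u)) :: real ^ 'k \<Rightarrow> ennreal"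
  let ?S = "\<lambda>x :: real ^ 'm. ennreal (sample_sd x ^ k)"
  have T: "F_T (x, Y x r t) = 1 / (norm t)\<^sup>2" if "sample_sd x > 0" for x r t
  proof -
    have "sample_var x = (sample_sd x)\<^sup>2"
      using that by (simp add: sample_sd_def)
    then show ?thesis
      using that k P by (simp add: F_T_def Y_def sample_var_orthogonal power_mult_distrib)
  qed
  have inner: "(\<integral>\<^sup>+t. h (x, r *\<^sub>R unit_diag + A (append_zero t)) \<partial>lborel)
      = (\<integral>\<^sup>+t. ?K * (?S x * H x r t * ?B t) \<partial>lborel)" for x r
  proof (cases "sample_sd x > 0")
    case True
    have "(\<integral>\<^sup>+t. h (x, r *\<^sub>R unit_diag + A (append_zero t)) \<partial>lborel)
        = ennreal ((sqrt k * sample_sd x) ^ k) * (\<integral>\<^sup>+t. h (x, r *\<^sub>R unit_diag + A (append_zero ((sqrt k * sample_sd x) *\<^sub>R t))) \<partial>lborel)"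
      using True k by (subst nn_integral_lborel_scale[where c = "sqrt k * sample_sd x"]) (auto simp: k_def)
    also have "\<dots> = (\<integral>\<^sup>+t. ennreal ((sqrt k * sample_sd x) ^ k) * h (x, Y x r t) \<partial>lborel)"
      unfolding Y_def by (subst nn_integral_cmult) (auto simp: A.scale)
    also have "\<dots> = (\<integral>\<^sup>+t. ?K * (?S x * H x r t * ?B t) \<partial>lborel)"
    proof (rule nn_integral_cong_AE)
      have "AE t in lborel. t \<noteq> (0 :: real ^ 'k)"
        by (rule AE_lborel_singleton)
      then show "AE t in lborel. ennreal ((sqrt k * sample_sd x) ^ k) * h (x, Y x r t) = ?K * (?S x * H x r t * ?B t)"
      proof eventually_elim
        case (elim t)
        \<comment> \<open>Square roots reduce the event to the ball criterion for
          \<open>1 / norm t\<close>, now at level \<open>sqrt u\<close>.\<close>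
        have "u < 1 / (norm t)\<^sup>2 \<longleftrightarrow> sqrt u < 1 / norm t"
        proof -
          have "u < 1 / (norm t)\<^sup>2 \<longleftrightarrow> sqrt u < sqrt (1 / (norm t)\<^sup>2)"
            by simp
          then show ?thesis
            by (simp only: real_sqrt_divide real_sqrt_one real_sqrt_abs abs_norm_cancel)
        qed
        then have "indicator {x. F_T x > u} (x, Y x r t) = ?B t"
          using less_inverse_norm_iff[of "sqrt u" t] u elim T[OF True, of r t] by (simp add: indicator_def)
        moreover have "(sqrt k * sample_sd x) ^ k = real k powr (real k / 2) * sample_sd x ^ k"
          using k by (simp add: power_mult_distrib power_sqrt)
        ultimately show ?case
          using True by (simp add: h_def H_def ennreal_mult mult_ac)
      qed
    qed
    finally show ?thesis .
  next
    case False
    \<comment> \<open>Both sides vanish: here \<open>F_T = 0\<close>, also when the second variance is \<open>0\<close>, as \<open>0 / 0 = 0\<close>.\<close>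
    then have "sample_sd x = 0"
      using sample_sd_nonneg[of x] by simp
    moreover from this have "F_T (x, y) = 0" for y :: "real ^ ('k option)"
      by (simp add: F_T_def sample_sd_def)
    ultimately show ?thesis
      using u k by (simp add: h_def zero_power)
  qed
  have FT' [measurable]: "(F_T :: (real ^ 'm) \<times> (real ^ ('k option)) \<Rightarrow> real) \<in> borel_measurable borel"
    using FT by (simp add: borel_prod)
  have "ennreal (measure M {s \<in> space M. F_T (Z s) > u}) = (\<integral>\<^sup>+z. h z \<partial>lborel)"
    using prob_gt_eq_nn_integral[OF X FT', of u] by (simp add: h_def)
  also have "\<dots> = (\<integral>\<^sup>+x. \<integral>\<^sup>+y. h (x, y) \<partial>lborel \<partial>lborel)"
    unfolding lborel_prod[symmetric] by (intro lborel.nn_integral_fst[symmetric]) measurable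
  also have "\<dots> = (\<integral>\<^sup>+x. \<integral>\<^sup>+r. \<integral>\<^sup>+t. ?K * (?S x * H x r t * ?B t) \<partial>lborel \<partial>lborel \<partial>lborel)"
    by (subst nn_integral_one_sample_rotation[OF A]) (auto simp: inner)
  also have "\<dots> = (\<integral>\<^sup>+x. \<integral>\<^sup>+t. \<integral>\<^sup>+r. ?K * (?S x * H x r t * ?B t) \<partial>lborel \<partial>lborel \<partial>lborel)"
    unfolding H_def Y_def by (rule nn_integral_cong, rule lborel_pair.Fubini') measurable
  also have "\<dots> = (\<integral>\<^sup>+t. \<integral>\<^sup>+x. \<integral>\<^sup>+r. ?K * (?S x * H x r t * ?B t) \<partial>lborel \<partial>lborel \<partial>lborel)"
    unfolding H_def Y_def by (rule lborel_pair.Fubini') measurable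
  also have "\<dots> = (\<integral>\<^sup>+t\<in>ball 0 (1 / sqrt u). F_G A g t \<partial>lborel)"
  proof (rule nn_integral_cong)
    fix t
    have "(\<integral>\<^sup>+x. \<integral>\<^sup>+r. ?K * (?S x * H x r t * ?B t) \<partial>lborel \<partial>lborel)
        = ?K * (\<integral>\<^sup>+x. ?S x * (\<integral>\<^sup>+r. H x r t \<partial>lborel) \<partial>lborel) * ?B t"
      unfolding H_def Y_def by (cases "t \<in> ball 0 (1 / sqrt u)") (simp_all add: nn_integral_cmult)
    then show "(\<integral>\<^sup>+x. \<integral>\<^sup>+r. ?K * (?S x * H x r t * ?B t) \<partial>lborel \<partial>lborel) = F_G A g t * ?B t"
      unfolding F_G_def k(2) H_def Y_def Let_def by simp
  qed
  finally show ?thesis .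
qed

section \<open>The two-sample statistic\<close>

lemma sum_UNIV_sum: "(\<Sum>l\<in>UNIV. f l) = (\<Sum>i\<in>UNIV. f (Inl i)) + (\<Sum>j\<in>UNIV. f (Inr j))"
  for f :: "'i::finite + 'j::finite \<Rightarrow> real"
  using sum.Plus[of UNIV UNIV f] by simp

lemma prod_UNIV_sum: "(\<Prod>l\<in>UNIV. f l) = (\<Prod>i\<in>UNIV. f (Inl i)) * (\<Prod>j\<in>UNIV. f (Inr j))"
  for f :: "'i::finite + 'j::finite \<Rightarrow> real"
  using prod.Plus[of UNIV UNIV f] by simp

text \<open>For two samples the factors \<open>c_1\<close> and \<open>c_2\<close> may differ, so the
  scaling of t is diagonal rather than scalar.\<close>

lemma nn_integral_lborel_scale_coordinates:
  fixes h :: "real ^ 'i \<Rightarrow> ennreal" and c :: "'i \<Rightarrow> real"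
  assumes [measurable]: "h \<in> borel_measurable borel" and c: "\<And>i. c i > 0"
  shows "(\<integral>\<^sup>+x. h x \<partial>lborel) = ennreal (\<Prod>i\<in>UNIV. c i) * (\<integral>\<^sup>+x. h (\<chi> i. c i * x $ i) \<partial>lborel)"
proof -
  define v :: "real ^ 'i" where "v = (\<chi> i. c i)"
  have B: "(Basis :: (real ^ 'i) set) = (\<lambda>i. axis i 1) ` UNIV"
    by (auto simp: Basis_vec_def)
  have inj: "inj (\<lambda>i. axis i 1 :: real ^ 'i)"
    by (auto simp: inj_def axis_eq_axis)
  have v: "v \<bullet> axis i 1 = c i" for i
    by (simp add: v_def inner_axis)
  \<comment> \<open>Written in the shape of \<open>lborel_affine_euclidean\<close> with translation
    0.\<close>
  define T where "T x = 0 + (\<Sum>j\<in>Basis. ((v \<bullet> j) * (x \<bullet> j)) *\<^sub>R j)" for x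
  have T: "T x = (\<chi> i. c i * x $ i)" for x
  proof -
    have "T x $ i = c i * x $ i" for i
    proof -
      have "axis i 1 \<in> (Basis :: (real ^ 'i) set)"
        by (simp add: B)
      then have "T x \<bullet> axis i 1 = (v \<bullet> axis i 1) * (x \<bullet> axis i 1)"
        by (simp add: T_def)
      then show ?thesis
        by (simp add: v_def inner_axis)
    qed
    then show ?thesis
      by (simp add: vec_eq_iff)
  qed
  have [measurable]: "T \<in> borel_measurable borel"
    unfolding T_def by measurable
  have "lborel = density (distr lborel borel T) (\<lambda>_. ennreal (\<Prod>j\<in>Basis. \<bar>v \<bullet> j\<bar>))"
    unfolding T_def using c by (intro lborel_affine_euclidean) (auto simp: B v less_imp_neq[symmetric])
  moreover have "(\<Prod>j\<in>Basis. \<bar>v \<bullet> j\<bar>) = (\<Prod>i\<in>UNIV. c i)"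
    unfolding B using inj c by (simp add: prod.reindex v abs_of_pos)
  ultimately have "(\<integral>\<^sup>+x. h x \<partial>lborel) = (\<integral>\<^sup>+x. h x \<partial>density (distr lborel borel T) (\<lambda>_. ennreal (\<Prod>i\<in>UNIV. c i)))"
    by simp
  also have "\<dots> = ennreal (\<Prod>i\<in>UNIV. c i) * (\<integral>\<^sup>+x. h (T x) \<partial>lborel)"
    by (simp add: nn_integral_density nn_integral_distr nn_integral_cmult)
  finally show ?thesis
    by (simp add: T)
qed

section \<open>The two blocks of a pooled sample\<close>

lemma inner_blocks: "x \<bullet> y = block1 x \<bullet> block1 y + block2 x \<bullet> block2 y"
  by (simp add: inner_vec_def sum_UNIV_sum block1_def block2_def)

lemma linear_block1: "linear block1" and linear_block2: "linear block2"
  by (auto intro!: linearI simp: block1_def block2_def vec_eq_iff)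

text \<open>For dimension reasons \<open>A\<close> maps the first block onto itself, hence also its orthogonal complement,
  the second block.\<close>
lemma orthogonal_blocks_norm:
  fixes A :: "real ^ ('i::finite + 'j::finite) \<Rightarrow> real ^ ('i + 'j)"
  assumes A: "orthogonal_transformation A" and inv: "\<And>x. block2 x = 0 \<Longrightarrow> block2 (A x) = 0"
  shows "norm (block1 (A z)) = norm (block1 z)" "norm (block2 (A z)) = norm (block2 z)"
proof -
  interpret b1: linear "block1 :: real ^ ('i + 'j) \<Rightarrow> real ^ 'i" by (rule linear_block1)
  interpret b2: linear "block2 :: real ^ ('i + 'j) \<Rightarrow> real ^ 'j" by (rule linear_block2)
  have linA: "linear A"
    using A by (rule orthogonal_transformation_linear)
  define V where "V = {x :: real ^ ('i + 'j). block2 x = 0}"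
  have V: "subspace V"
    unfolding V_def by (intro subspaceI) (auto simp: b2.add b2.scale b2.zero)
  have "inj A"
    using A by (rule orthogonal_transformation_inj)
  then have "dim (A ` V) = dim V"
    using linA by (intro dim_image_eq) (auto intro: inj_on_subset)
  moreover have "A ` V \<subseteq> V"
    using inv by (auto simp: V_def)
  ultimately have AV: "A ` V = V"
    using V linear_subspace_image[OF linA V] by (intro subspace_dim_equal) auto
  have inner: "A x \<bullet> A y = x \<bullet> y" for x y
    using A by (simp add: orthogonal_transformation_def)
  define e where "e w = ((\<chi> l. case l of Inl i \<Rightarrow> w $ i | Inr _ \<Rightarrow> 0) :: real ^ ('i + 'j))" for w :: "real ^ 'i"
  have e: "block1 (e w) = w" "block2 (e w) = 0" for w
    by (simp_all add: e_def block1_def block2_def vec_eq_iff)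
  have W: "block1 (A x) = 0" if x: "block1 x = 0" for x
  proof -
    \<comment> \<open>The first block of \<open>A x\<close>, padded by zeros, is the image of some y
      in the first block, while x lies in the second; as A preserves inner products, that block is
      orthogonal to itself.\<close>
    have "e (block1 (A x)) \<in> A ` V"
      unfolding AV by (simp add: V_def e)
    then obtain y where y: "block2 y = 0" "e (block1 (A x)) = A y"
      by (auto simp: V_def)
    have "block1 (A x) \<bullet> block1 (A x) = A x \<bullet> e (block1 (A x))"
      by (simp add: inner_blocks e)
    also have "\<dots> = x \<bullet> y"
      by (simp add: y inner)
    also have "\<dots> = 0"
      using x y by (simp add: inner_blocks)
    finally show ?thesis
      by simp
  qed
  define z1 where "z1 = e (block1 z)"
  define z2 where "z2 = z - z1"
  have z: "z = z1 + z2" "block2 z1 = 0" "block1 z1 = block1 z" "block1 z2 = 0" "block2 z2 = block2 z"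
    by (simp_all add: z1_def z2_def e b1.diff b2.diff)
  have Az: "A z = A z1 + A z2"
    using linA by (simp add: z(1) linear_add)
  have n: "(norm x)\<^sup>2 = (norm (block1 x))\<^sup>2 + (norm (block2 x))\<^sup>2" for x :: "real ^ ('i + 'j)"
    by (simp add: power2_norm_eq_inner inner_blocks)
  have nA: "norm (A x) = norm x" for x
    using A by (simp add: orthogonal_transformation)
  have "(norm (block1 (A z1)))\<^sup>2 = (norm (block1 z))\<^sup>2"
    using n[of "A z1"] n[of z1] inv[OF z(2)] z by (simp add: nA)
  then show "norm (block1 (A z)) = norm (block1 z)"
    using W[OF z(4)] by (simp add: Az b1.add)
  have "(norm (block2 (A z2)))\<^sup>2 = (norm (block2 z))\<^sup>2"
    using n[of "A z2"] n[of z2] W[OF z(4)] z by (simp add: nA)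
  then show "norm (block2 (A z)) = norm (block2 z)"
    using inv[OF z(2)] by (simp add: Az b2.add)
qed

text \<open>This quadratic form is the squared denominator of the statistic. With equal weights it
  is a multiple of the squared norm, invariant under every orthogonal map; otherwise A respects the
  blocks and preserves each block norm.\<close>

lemma two_sample_rotation_norm:
  fixes A :: "real ^ ('p::finite option + 'q::finite option) \<Rightarrow> real ^ ('p option + 'q option)"
  assumes A: "two_sample_rotation a b A"
  shows "a / (real CARD('p option) - 1) * (norm (block1 (A z)))\<^sup>2 + b / (real CARD('q option) - 1) * (norm (block2 (A z)))\<^sup>2
    = a / (real CARD('p option) - 1) * (norm (block1 z))\<^sup>2 + b / (real CARD('q option) - 1) * (norm (block2 z))\<^sup>2"
proof (cases "(real CARD('p option) - 1) / a = (real CARD('q option) - 1) / b")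
  case True
  then have "a / (real CARD('p option) - 1) = b / (real CARD('q option) - 1)"
    by (metis inverse_divide)
  moreover have "(norm (block1 (A z)))\<^sup>2 + (norm (block2 (A z)))\<^sup>2 = (norm (block1 z))\<^sup>2 + (norm (block2 z))\<^sup>2"
    using A by (simp add: power2_norm_eq_inner inner_blocks[symmetric] two_sample_rotation_def orthogonal_transformation_def)
  ultimately show ?thesis
    by (simp only: distrib_left[symmetric])
next
  case False
  then show ?thesis
    using A orthogonal_blocks_norm[of A z] by (simp add: two_sample_rotation_def)
qed

text \<open>This is \<open>two_sample_v\<close> without the factors \<open>c_1\<close> and
  \<open>c_2\<close>: the padding is isometric, and the scaling is carried out separately.\<close>

definition pad_zeros :: "real ^ ('p::finite + 'q::finite) \<Rightarrow> real ^ ('p option + 'q option)" where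
  "pad_zeros t = (\<chi> l. case l of
     Inl None \<Rightarrow> 0 | Inl (Some i) \<Rightarrow> t $ Inl i | Inr None \<Rightarrow> 0 | Inr (Some j) \<Rightarrow> t $ Inr j)"

lemma pad_zeros_blocks: "block1 (pad_zeros t) = append_zero (block1 t)" "block2 (pad_zeros t) = append_zero (block2 t)"
  by (simp_all add: pad_zeros_def append_zero_def block1_def block2_def vec_eq_iff split: option.split)

lemma linear_pad_zeros: "linear pad_zeros"
  by (rule linearI) (auto simp: pad_zeros_def vec_eq_iff split: option.split sum.split)

lemma borel_measurable_pad_zeros [measurable]: "pad_zeros \<in> borel_measurable borel"
  by (intro borel_measurable_linear linear_pad_zeros)

lemma axis_inner_pad_zeros: "axis (Inl None) 1 \<bullet> pad_zeros t = 0" "axis (Inr None) 1 \<bullet> pad_zeros t = 0"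
  by (simp_all add: inner_axis' pad_zeros_def)

lemma I1_I2_blocks: "block1 I1 = unit_diag" "block2 I1 = 0" "block1 I2 = 0" "block2 I2 = unit_diag"
  by (simp_all add: I1_def I2_def block1_def block2_def unit_diag_def vec_eq_iff)

lemma borel_measurable_blocks [measurable]: "block1 \<in> borel_measurable borel" "block2 \<in> borel_measurable borel"
  by (intro borel_measurable_linear linear_block1 linear_block2)+

lemma two_sample_rotation_inner:
  assumes "two_sample_rotation a b A"
  shows "I1 \<bullet> A (pad_zeros t) = 0" "I2 \<bullet> A (pad_zeros t) = 0"
    "unit_diag \<bullet> block1 (A (pad_zeros t)) = 0" "unit_diag \<bullet> block2 (A (pad_zeros t)) = 0"
proof -
  have A: "A x \<bullet> A y = x \<bullet> y" "A (axis (Inl None) 1) = I1" "A (axis (Inr None) 1) = I2" for x y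
    using assms by (auto simp: two_sample_rotation_def orthogonal_transformation_def)
  show *: "I1 \<bullet> A (pad_zeros t) = 0" "I2 \<bullet> A (pad_zeros t) = 0"
    unfolding A(2,3)[symmetric] A(1) by (rule axis_inner_pad_zeros)+
  then show "unit_diag \<bullet> block1 (A (pad_zeros t)) = 0" "unit_diag \<bullet> block2 (A (pad_zeros t)) = 0"
    by (simp_all add: inner_blocks I1_I2_blocks)
qed

text \<open>The angle is chosen so that \<open>two_sample_w 0\<close> is the direction in L in which
  the difference of the sample means grows fastest, and \<open>two_sample_w (pi / 2)\<close> is the
  diagonal of the pooled sample.\<close>

lemma omega0_cos_sin:
  assumes "n1 > 0" "n2 > 0"
  shows "cos (omega0 n1 n2) = sqrt (real n2 / real (n1 + n2))" "sin (omega0 n1 n2) = sqrt (real n1 / real (n1 + n2))"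
proof -
  have le: "real n2 / real (n1 + n2) \<le> 1"
    using assms by (simp add: field_simps)
  then have "sqrt (real n2 / real (n1 + n2)) \<le> 1"
    by simp
  moreover have "-1 \<le> sqrt (real n2 / real (n1 + n2))"
    using real_sqrt_ge_zero[of "real n2 / real (n1 + n2)"] by (simp add: order_trans[of "-1" 0])
  ultimately show "cos (omega0 n1 n2) = sqrt (real n2 / real (n1 + n2))"
    "sin (omega0 n1 n2) = sqrt (real n1 / real (n1 + n2))"
    using assms le by (simp_all add: omega0_def sin_arccos field_simps)
qed

text \<open>Thus r and \<omega> are polar coordinates with respect to the orthonormal basis
  \<open>two_sample_w 0\<close>, \<open>two_sample_w (pi / 2)\<close> of L.\<close>

lemma two_sample_w_rotate:
  "r *\<^sub>R two_sample_w \<omega> = (r * cos \<omega>) *\<^sub>R two_sample_w 0 + (r * sin \<omega>) *\<^sub>R two_sample_w (pi / 2)"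
  by (simp add: two_sample_w_def cos_diff sin_diff algebra_simps)

text \<open>The coordinate q shifts all observations by a common amount and drops out of the
  statistic.\<close>

lemma two_sample_T_eq:
  fixes A :: "real ^ ('p::finite option + 'q::finite option) \<Rightarrow> real ^ ('p option + 'q option)"
  assumes A: "two_sample_rotation a b A"
  shows "two_sample_T a b (p *\<^sub>R two_sample_w 0 + q *\<^sub>R two_sample_w (pi / 2) + A (pad_zeros t))
    = p * sqrt (1 / real CARD('p option) + 1 / real CARD('q option))
      / sqrt (a / real CARD('p) * (norm (block1 t))\<^sup>2 + b / real CARD('q) * (norm (block2 t))\<^sup>2)"
proof -
  define n1 n2 where n: "n1 = CARD('p option)" "n2 = CARD('q option)"
  have pos: "n1 > 0" "n2 > 0" and n': "real n1 - 1 = real CARD('p)" "real n2 - 1 = real CARD('q)"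
    by (simp_all add: n)
  define c s where cs: "c = sqrt (real n2 / real (n1 + n2))" "s = sqrt (real n1 / real (n1 + n2))"
  have cos_sin: "cos (omega0 n1 n2) = c" "sin (omega0 n1 n2) = s"
    using omega0_cos_sin[OF pos] by (simp_all add: cs)
  have x: "p *\<^sub>R two_sample_w 0 + q *\<^sub>R two_sample_w (pi / 2) + A (pad_zeros t)
    = (p * c + q * s) *\<^sub>R I1 + (q * c - p * s) *\<^sub>R I2 + A (pad_zeros t)" (is "?x = _")
    unfolding two_sample_w_def n[symmetric] by (simp add: cos_diff sin_diff cos_sin algebra_simps)
  have b: "block1 ?x = (p * c + q * s) *\<^sub>R unit_diag + block1 (A (pad_zeros t))"
    "block2 ?x = (q * c - p * s) *\<^sub>R unit_diag + block2 (A (pad_zeros t))"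
    unfolding x by (simp_all add: linear_add[OF linear_block1] linear_add[OF linear_block2]
        linear_cmul[OF linear_block1] linear_cmul[OF linear_block2] I1_I2_blocks)
  note orth = two_sample_rotation_inner(3,4)[OF A]
  have "sample_mean (block1 ?x) - sample_mean (block2 ?x)
      = (p * c + q * s) / sqrt (real n1) - (q * c - p * s) / sqrt (real n2)"
    unfolding b by (simp only: sample_mean_orthogonal[OF orth(1)] sample_mean_orthogonal[OF orth(2)] n)
  also have "\<dots> = p * (c / sqrt (real n1) + s / sqrt (real n2)) + q * (s / sqrt (real n1) - c / sqrt (real n2))"
    by (simp add: algebra_simps add_divide_distrib diff_divide_distrib)
  also have "s / sqrt (real n1) - c / sqrt (real n2) = 0"
    using pos by (simp add: cs real_sqrt_divide)
  \<comment> \<open>The remaining coefficient is the norm of the functional "difference of the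
    sample means" on L.\<close>
  also have "c / sqrt (real n1) + s / sqrt (real n2) = sqrt (1 / real n1 + 1 / real n2)"
  proof -
    have "1 / real n1 + 1 / real n2 = real (n1 + n2) / (real n1 * real n2)"
      using pos by (simp add: field_simps)
    moreover have "sqrt (real (n1 + n2)) * sqrt (real (n1 + n2)) = real (n1 + n2)"
      by (rule real_sqrt_mult_self[THEN trans]) simp
    moreover have "sqrt (real n1) * sqrt (real n1) = real n1" "sqrt (real n2) * sqrt (real n2) = real n2"
      by simp_all
    ultimately show ?thesis
      using pos by (simp add: cs real_sqrt_divide real_sqrt_mult field_simps)
  qed
  finally have mean: "sample_mean (block1 ?x) - sample_mean (block2 ?x) = p * sqrt (1 / real n1 + 1 / real n2)"
    by simp
  have "a * sample_var (block1 ?x) + b * sample_var (block2 ?x)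
      = a / (real n1 - 1) * (norm (block1 (A (pad_zeros t))))\<^sup>2 + b / (real n2 - 1) * (norm (block2 (A (pad_zeros t))))\<^sup>2"
    unfolding b by (simp add: sample_var_orthogonal[OF orth(1)] sample_var_orthogonal[OF orth(2)] n)
  also have "\<dots> = a / (real n1 - 1) * (norm (block1 (pad_zeros t)))\<^sup>2 + b / (real n2 - 1) * (norm (block2 (pad_zeros t)))\<^sup>2"
    unfolding n by (rule two_sample_rotation_norm[OF A])
  also have "\<dots> = a / real CARD('p) * (norm (block1 t))\<^sup>2 + b / real CARD('q) * (norm (block2 t))\<^sup>2"
    unfolding n' pad_zeros_blocks norm_append_zero ..
  finally show ?thesis
    unfolding two_sample_T_def mean n by simp
qed

lemma nn_integral_two_sample_rotation:
  fixes A :: "real ^ ('p::finite option + 'q::finite option) \<Rightarrow> real ^ ('p option + 'q option)"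
  assumes A: "two_sample_rotation a b A" and [measurable]: "h \<in> borel_measurable borel"
  shows "(\<integral>\<^sup>+y. h y \<partial>lborel) = (\<integral>\<^sup>+p. \<integral>\<^sup>+q. \<integral>\<^sup>+t.
    h (p *\<^sub>R two_sample_w 0 + q *\<^sub>R two_sample_w (pi / 2) + A (pad_zeros t)) \<partial>lborel \<partial>lborel \<partial>lborel)"
proof -
  have oA: "orthogonal_transformation A"
    using A by (simp add: two_sample_rotation_def)
  then have linA: "linear A"
    by (rule orthogonal_transformation_linear)
  have [measurable]: "A \<in> borel_measurable borel"
    using linA by (rule borel_measurable_linear)
  define f where "f = (\<lambda>(z, t). fst z *\<^sub>R two_sample_w 0 + snd z *\<^sub>R two_sample_w (pi / 2) + A (pad_zeros t))"
  have "linear f"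
    by (rule linearI) (auto simp: f_def linear_add[OF linear_pad_zeros] linear_cmul[OF linear_pad_zeros]
        linear_add[OF linA] linear_cmul[OF linA] algebra_simps)
  moreover have "norm (f x) = norm x" for x
  proof -
    obtain p q t where x: "x = ((p, q), t)" by (metis surj_pair)
    define \<theta> where "\<theta> = omega0 CARD('p option) CARD('q option)"
    \<comment> \<open>P and Q are the coordinates with respect to \<open>I1\<close> and
      \<open>I2\<close>; they arise from p and q by a plane rotation.\<close>
    define P where "P = p * cos \<theta> + q * sin \<theta>"
    define Q where "Q = q * cos \<theta> - p * sin \<theta>"
    have f: "f x = P *\<^sub>R I1 + Q *\<^sub>R I2 + A (pad_zeros t)"
      unfolding f_def x two_sample_w_def \<theta>_def[symmetric] by (simp add: cos_diff sin_diff P_def Q_def algebra_simps)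
    have I: "(I1 :: real ^ ('p option + 'q option)) \<bullet> I1 = 1" "(I2 :: real ^ ('p option + 'q option)) \<bullet> I2 = 1"
      "(I1 :: real ^ ('p option + 'q option)) \<bullet> I2 = 0"
      by (simp_all add: inner_blocks I1_I2_blocks) (simp_all add: inner_vec_def unit_diag_def)
    note Z = two_sample_rotation_inner(1,2)[OF A]
    have Z': "A (pad_zeros t) \<bullet> I1 = 0" "A (pad_zeros t) \<bullet> I2 = 0"
      and I': "(I2 :: real ^ ('p option + 'q option)) \<bullet> I1 = 0"
      using Z I(3) by (simp_all add: inner_commute)
    have "(norm (f x))\<^sup>2 = P\<^sup>2 + Q\<^sup>2 + A (pad_zeros t) \<bullet> A (pad_zeros t)"
      unfolding f power2_norm_eq_inner
      by (simp add: inner_add_left inner_add_right I Z I' Z' power2_eq_square)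
    also have "A (pad_zeros t) \<bullet> A (pad_zeros t) = pad_zeros t \<bullet> pad_zeros t"
      using oA by (simp add: orthogonal_transformation_def)
    also have "\<dots> = (norm t)\<^sup>2"
      unfolding inner_blocks[of "pad_zeros t"] pad_zeros_blocks power2_norm_eq_inner inner_blocks[of t]
      by (simp add: power2_norm_eq_inner[symmetric] norm_append_zero)
    also have "P\<^sup>2 + Q\<^sup>2 = (p\<^sup>2 + q\<^sup>2) * ((cos \<theta>)\<^sup>2 + (sin \<theta>)\<^sup>2)"
      unfolding P_def Q_def by algebra
    finally have "(norm (f x))\<^sup>2 = p\<^sup>2 + q\<^sup>2 + (norm t)\<^sup>2"
      by simp
    then show ?thesis
      by (simp add: x norm_Pair real_sqrt_unique)
  qed
  ultimately have "(\<integral>\<^sup>+y. h y \<partial>lborel) = (\<integral>\<^sup>+z. \<integral>\<^sup>+t. h (f (z, t)) \<partial>lborel \<partial>lborel)"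
    by (intro nn_integral_isometry_pair) auto
  also have "\<dots> = (\<integral>\<^sup>+p. \<integral>\<^sup>+q. \<integral>\<^sup>+t. h (f ((p, q), t)) \<partial>lborel \<partial>lborel \<partial>lborel)"
    unfolding lborel_prod[symmetric, where 'a = real and 'b = real] f_def prod.case
    by (rule lborel.nn_integral_fst[symmetric]) measurable
  finally show ?thesis
    by (simp add: f_def)
qed

text \<open>The weight of \<open>G\<close> is a product: polar coordinates contribute r, and
  rescaling the n - 2 coordinates of t by multiples of \<open>r * cos \<omega>\<close> contributes
  \<open>(r * cos \<omega>) ^ (n - 2)\<close> times the constant M.\<close>

lemma two_sample_prob:
  fixes A :: "real ^ ('p::finite option + 'q::finite option) \<Rightarrow> real ^ ('p option + 'q option)"
  assumes X: "has_continuous_density M X g" and A: "two_sample_rotation a b A" and u: "u > 0" and ab: "a > 0" "b > 0"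
  shows "ennreal (measure M {s \<in> space M. two_sample_T a b (X s) > u})
    = (\<integral>\<^sup>+t\<in>ball 0 (1 / u). two_sample_G a b A g t \<partial>lborel)"
proof -
  note [measurable] = has_continuous_densityD(1)[OF X]
  have linA: "linear A"
    using A by (simp add: two_sample_rotation_def orthogonal_transformation_linear)
  have [measurable]: "A \<in> borel_measurable borel"
    using linA by (rule borel_measurable_linear)
  have ball [measurable]: "ball (0 :: real ^ ('p + 'q)) r \<in> sets borel" for r
    by simp
  define n where "n = CARD('p option) + CARD('q option)"
  define N where "N = 1 / real CARD('p option) + 1 / real CARD('q option)"
  \<comment> \<open>The factors \<open>c_1\<close> and \<open>c_2\<close> with
    \<open>cos \<omega>\<close> removed, so that the scaling by \<open>p * D l\<close> involves the
    angle only through \<open>p = r cos \<omega>\<close>.\<close>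
  define D where "D = (\<lambda>l :: 'p + 'q. case l of Inl _ \<Rightarrow> sqrt N * sqrt (real CARD('p) / a) | Inr _ \<Rightarrow> sqrt N * sqrt (real CARD('q) / b))"
  have n: "n - 2 = CARD('p) + CARD('q)" "n - 1 = Suc (CARD('p) + CARD('q))"
    by (simp_all add: n_def)
  have N: "N > 0"
    by (simp add: N_def add_pos_pos)
  have D: "D l > 0" for l
    using N ab by (simp add: D_def split: sum.split)
  define Mc where "Mc = two_sample_M a b CARD('p option) CARD('q option)"
  have Mc: "Mc \<ge> 0"
    by (simp add: Mc_def two_sample_M_def)
  have prod: "(\<Prod>l\<in>UNIV. x * D l) = x ^ (n - 2) * Mc" for x
  proof -
    have "(\<Prod>l\<in>UNIV. D l) = sqrt N ^ (CARD('p) + CARD('q)) * (sqrt (real CARD('p) / a) ^ CARD('p) * sqrt (real CARD('q) / b) ^ CARD('q))"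
      by (simp add: prod_UNIV_sum D_def power_mult_distrib power_add)
    also have "\<dots> = Mc"
      using N ab by (simp add: power_sqrt Mc_def two_sample_M_def N_def)
    finally show ?thesis
      by (simp add: prod.distrib n(1))
  qed
  have [measurable]: "(two_sample_T a b :: real ^ ('p option + 'q option) \<Rightarrow> real) \<in> borel_measurable borel"
    unfolding two_sample_T_def[abs_def] by measurable
  define h where "h x = ennreal (g x) * indicator {x. two_sample_T a b x > u} x" for x
  have [measurable]: "h \<in> borel_measurable borel"
    unfolding h_def by measurable
  define Y where "Y p q t = p *\<^sub>R two_sample_w 0 + q *\<^sub>R two_sample_w (pi / 2) + A (pad_zeros t)" for p q and t :: "real ^ ('p + 'q)"
  define S where "S p t = (\<chi> l. p * D l * t $ l)" for p and t :: "real ^ ('p + 'q)"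
  \<comment> \<open>Splitting off the scalar p leaves a fixed linear map, whose measurability gives
    joint measurability in all variables.\<close>
  define E where "E t = (\<chi> l. D l * t $ l)" for t :: "real ^ ('p + 'q)"
  have "linear E"
    by (rule linearI) (simp_all add: E_def vec_eq_iff algebra_simps)
  then have [measurable]: "E \<in> borel_measurable borel"
    by (rule borel_measurable_linear)
  have SE: "S p t = p *\<^sub>R E t" for p t
    by (simp add: S_def E_def vec_eq_iff)
  define Z where "Z \<omega> r t = r *\<^sub>R (two_sample_w \<omega> + A (two_sample_v a b t \<omega>))" for \<omega> r and t :: "real ^ ('p + 'q)"
  have YZ: "Y (r * cos \<omega>) (r * sin \<omega>) (S (r * cos \<omega>) t) = Z \<omega> r t" for r \<omega> t
  proof -
    have "pad_zeros (S (r * cos \<omega>) t) = r *\<^sub>R two_sample_v a b t \<omega>"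
      by (auto simp: vec_eq_iff pad_zeros_def S_def D_def N_def two_sample_v_def two_sample_c_def Let_def
          split: sum.split option.split)
    then show ?thesis
      unfolding Y_def Z_def scaleR_add_right two_sample_w_rotate[of r \<omega>] linear_cmul[OF linA, symmetric] by (simp only:)
  qed
  let ?B = "indicator (ball 0 (1 / u)) :: real ^ ('p + 'q) \<Rightarrow> ennreal"
  have T: "two_sample_T a b (Y p q (S p t)) = 1 / norm t" if "p > 0" for p q t
  proof -
    have "a / real CARD('p) * (norm (block1 (S p t)))\<^sup>2 = p\<^sup>2 * N * (norm (block1 t))\<^sup>2"
    proof -
      have "block1 (S p t) = (p * (sqrt N * sqrt (real CARD('p) / a))) *\<^sub>R block1 t"
        by (simp add: S_def block1_def D_def vec_eq_iff)
      then show ?thesis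
        using N ab by (simp add: power_mult_distrib)
    qed
    moreover have "b / real CARD('q) * (norm (block2 (S p t)))\<^sup>2 = p\<^sup>2 * N * (norm (block2 t))\<^sup>2"
    proof -
      have "block2 (S p t) = (p * (sqrt N * sqrt (real CARD('q) / b))) *\<^sub>R block2 t"
        by (simp add: S_def block2_def D_def vec_eq_iff)
      then show ?thesis
        using N ab by (simp add: power_mult_distrib)
    qed
    moreover have "(norm (block1 t))\<^sup>2 + (norm (block2 t))\<^sup>2 = (norm t)\<^sup>2"
      by (simp add: power2_norm_eq_inner inner_blocks[of t])
    \<comment> \<open>\<open>D\<close> undoes the weights a and b of the two variances, so both
      blocks enter with the same factor and combine into the norm of t.\<close>
    ultimately have "sqrt (a / real CARD('p) * (norm (block1 (S p t)))\<^sup>2 + b / real CARD('q) * (norm (block2 (S p t)))\<^sup>2)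
        = p * sqrt N * norm t"
      using that by (simp only: distrib_left[symmetric]) (simp add: real_sqrt_mult)
    then show ?thesis
      unfolding Y_def two_sample_T_eq[OF A] N_def[symmetric] using that N by simp
  qed
  \<comment> \<open>Integrating t out leaves a function on the plane, to which polar coordinates
    apply; t is brought back afterwards for fixed r and \<omega>.\<close>
  define F where "F = (\<lambda>(p, q). \<integral>\<^sup>+t. h (Y p q t) \<partial>lborel)"
  have [measurable]: "F \<in> borel_measurable borel"
    unfolding borel_prod[symmetric] F_def Y_def by measurable
  have F0: "F (p, q) = 0" if "p \<le> 0" for p q
  proof -
    have "two_sample_T a b (Y p q t) \<le> 0" for t
      unfolding Y_def two_sample_T_eq[OF A] N_def[symmetric] using that N ab
      by (auto simp: divide_le_0_iff mult_le_0_iff)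
    then have "\<not> two_sample_T a b (Y p q t) > u" for t
      using u by (meson less_le_trans less_asym not_le order.strict_trans1)
    then show ?thesis
      by (simp add: F_def h_def)
  qed
  define H where "H \<omega> r t = ennreal (cos \<omega> ^ (n - 2)) * indicator {-pi/2..pi/2} \<omega> * (ennreal (r ^ (n - 1) * g (Z \<omega> r t)) * indicator {0<..} r)" for \<omega> r t
  have F1: "ennreal r * F (r * cos \<omega>, r * sin \<omega>) = (\<integral>\<^sup>+t. ennreal Mc * (H \<omega> r t * ?B t) \<partial>lborel)"
    if r: "r > 0" and \<omega>: "\<omega> \<in> {-pi/2<..<pi/2}" for r \<omega>
  proof -
    have c: "cos \<omega> > 0"
      using \<omega> by (intro cos_gt_zero_pi) auto
    then have p: "r * cos \<omega> > 0"
      using r by simp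
    have "F (r * cos \<omega>, r * sin \<omega>) = ennreal ((r * cos \<omega>) ^ (n - 2) * Mc) * (\<integral>\<^sup>+t. h (Y (r * cos \<omega>) (r * sin \<omega>) (S (r * cos \<omega>) t)) \<partial>lborel)"
      unfolding F_def prod.case S_def prod[symmetric] Y_def
      using p D by (intro nn_integral_lborel_scale_coordinates) auto
    also have "\<dots> = ennreal ((r * cos \<omega>) ^ (n - 2) * Mc) * (\<integral>\<^sup>+t. ennreal (g (Z \<omega> r t)) * ?B t \<partial>lborel)"
    proof (intro arg_cong2[of _ _ _ _ "(*)"] refl nn_integral_cong_AE)
      have "AE t in lborel. t \<noteq> (0 :: real ^ ('p + 'q))"
        by (rule AE_lborel_singleton)
      then show "AE t in lborel. h (Y (r * cos \<omega>) (r * sin \<omega>) (S (r * cos \<omega>) t)) = ennreal (g (Z \<omega> r t)) * ?B t"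
      proof eventually_elim
        case (elim t)
        have "indicator {x. two_sample_T a b x > u} (Z \<omega> r t) = ?B t"
          using less_inverse_norm_iff[OF u elim] T[OF p, of "r * sin \<omega>" t] by (simp add: indicator_def YZ)
        then show ?case
          by (simp add: YZ h_def)
      qed
    qed
    finally have "ennreal r * F (r * cos \<omega>, r * sin \<omega>)
        = ennreal r * ennreal ((r * cos \<omega>) ^ (n - 2) * Mc) * (\<integral>\<^sup>+t. ennreal (g (Z \<omega> r t)) * ?B t \<partial>lborel)"
      by (simp add: mult.assoc)
    also have "\<dots> = (\<integral>\<^sup>+t. ennreal r * ennreal ((r * cos \<omega>) ^ (n - 2) * Mc) * (ennreal (g (Z \<omega> r t)) * ?B t) \<partial>lborel)"
      unfolding YZ[symmetric] Y_def SE by (rule nn_integral_cmult[symmetric]) measurable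
    also have "\<dots> = (\<integral>\<^sup>+t. ennreal Mc * (H \<omega> r t * ?B t) \<partial>lborel)"
    proof (rule nn_integral_cong)
      fix t
      have "r * ((r * cos \<omega>) ^ (n - 2) * Mc) = Mc * (cos \<omega> ^ (n - 2) * r ^ (n - 1))"
        unfolding n by (simp add: power_mult_distrib)
      then have "ennreal r * ennreal ((r * cos \<omega>) ^ (n - 2) * Mc) = ennreal Mc * (ennreal (cos \<omega> ^ (n - 2)) * ennreal (r ^ (n - 1)))"
        using r c Mc by (simp add: ennreal_mult[symmetric])
      then show "ennreal r * ennreal ((r * cos \<omega>) ^ (n - 2) * Mc) * (ennreal (g (Z \<omega> r t)) * ?B t) = ennreal Mc * (H \<omega> r t * ?B t)"
        using r \<omega> has_continuous_densityD(2)[OF X] by (simp add: H_def ennreal_mult mult_ac)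
    qed
    finally show ?thesis .
  qed
  \<comment> \<open>Polar coordinates use the open interval of angles and \<open>G\<close> the
    closed one; at the endpoints the weight vanishes, as n - 2 > 0.\<close>
  have H_end: "H \<omega> r t = 0" if "\<omega> \<notin> {-pi/2<..<pi/2}" for \<omega> r t
  proof (cases "\<omega> = pi / 2 \<or> \<omega> = - (pi / 2)")
    case True
    then have "cos \<omega> = 0"
      by (metis cos_minus cos_pi_half)
    then show ?thesis
      by (simp add: H_def n(1) zero_power)
  next
    case False
    then show ?thesis
      using that by (auto simp: H_def indicator_def)
  qed
  have "ennreal (measure M {s \<in> space M. two_sample_T a b (X s) > u}) = (\<integral>\<^sup>+p. \<integral>\<^sup>+q. F (p, q) \<partial>lborel \<partial>lborel)"
    using prob_gt_eq_nn_integral[OF X, of "two_sample_T a b" u] nn_integral_two_sample_rotation[OF A, of h]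
    by (simp add: h_def[symmetric] F_def Y_def)
  also have "\<dots> = (\<integral>\<^sup>+p\<in>{0<..}. \<integral>\<^sup>+q. F (p, q) \<partial>lborel \<partial>lborel)"
    by (rule nn_integral_cong) (auto simp: indicator_def F0)
  also have "\<dots> = (\<integral>\<^sup>+\<omega>\<in>{-pi/2<..<pi/2}. \<integral>\<^sup>+r\<in>{0<..}. ennreal r * F (r * cos \<omega>, r * sin \<omega>) \<partial>lborel \<partial>lborel)"
    by (rule nn_integral_half_plane_polar) measurable
  also have "\<dots> = (\<integral>\<^sup>+\<omega>. \<integral>\<^sup>+r. \<integral>\<^sup>+t. ennreal Mc * (H \<omega> r t * ?B t) \<partial>lborel \<partial>lborel \<partial>lborel)"
  proof (rule nn_integral_cong)
    fix \<omega> :: real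
    show "(\<integral>\<^sup>+r\<in>{0<..}. ennreal r * F (r * cos \<omega>, r * sin \<omega>) \<partial>lborel) * indicator {-pi/2<..<pi/2} \<omega>
        = (\<integral>\<^sup>+r. \<integral>\<^sup>+t. ennreal Mc * (H \<omega> r t * ?B t) \<partial>lborel \<partial>lborel)"
    proof (cases "\<omega> \<in> {-pi/2<..<pi/2}")
      case True
      have "ennreal r * F (r * cos \<omega>, r * sin \<omega>) * indicator {0<..} r = (\<integral>\<^sup>+t. ennreal Mc * (H \<omega> r t * ?B t) \<partial>lborel)" for r
        using F1[OF _ True, of r] by (cases "r > 0") (auto simp: H_def)
      then show ?thesis
        using True by simp
    next
      case False
      then show ?thesis
        using H_end[OF False] by (auto simp: indicator_def)
    qed
  qed
  also have "\<dots> = (\<integral>\<^sup>+\<omega>. \<integral>\<^sup>+t. \<integral>\<^sup>+r. ennreal Mc * (H \<omega> r t * ?B t) \<partial>lborel \<partial>lborel \<partial>lborel)"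
    unfolding H_def YZ[symmetric] Y_def SE by (rule nn_integral_cong, rule lborel_pair.Fubini') measurable
  also have "\<dots> = (\<integral>\<^sup>+t. \<integral>\<^sup>+\<omega>. \<integral>\<^sup>+r. ennreal Mc * (H \<omega> r t * ?B t) \<partial>lborel \<partial>lborel \<partial>lborel)"
    unfolding H_def YZ[symmetric] Y_def SE by (rule lborel_pair.Fubini') measurable
  also have "\<dots> = (\<integral>\<^sup>+t\<in>ball 0 (1 / u). two_sample_G a b A g t \<partial>lborel)"
  proof (rule nn_integral_cong)
    fix t
    have "(\<integral>\<^sup>+\<omega>. \<integral>\<^sup>+r. ennreal Mc * (H \<omega> r t * ?B t) \<partial>lborel \<partial>lborel)
      = ennreal Mc * (\<integral>\<^sup>+\<omega>. ennreal (cos \<omega> ^ (n - 2)) * indicator {-pi/2..pi/2} \<omega>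
         * (\<integral>\<^sup>+r. ennreal (r ^ (n - 1) * g (Z \<omega> r t)) * indicator {0<..} r \<partial>lborel) \<partial>lborel) * ?B t"
      unfolding H_def YZ[symmetric] Y_def SE by (cases "t \<in> ball 0 (1 / u)") (simp_all add: nn_integral_cmult)
    then show "(\<integral>\<^sup>+\<omega>. \<integral>\<^sup>+r. ennreal Mc * (H \<omega> r t * ?B t) \<partial>lborel \<partial>lborel) = two_sample_G a b A g t * ?B t"
      unfolding two_sample_G_def Let_def n_def[symmetric] Mc_def[symmetric] Z_def by (simp add: mult_ac)
  qed
  finally show ?thesis .
qed

section \<open>Matching the leading constants\<close>

text \<open>\<open>Beta (1/2) (k/2)\<close> supplies the Gamma value that cancels the one in
  \<open>K_g\<close> and a factor \<open>sqrt pi\<close>;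
  \<open>Gamma (k/2 + 1) = k/2 * Gamma (k/2)\<close> matches what is left with the volume of the
  ball.\<close>

lemma student_constant:
  assumes "k > 0"
  shows "2 * pi powr ((real k + 1) / 2) / Gamma ((real k + 1) / 2) * tail_coeff 2 1 k = unit_ball_vol k * real k powr (real k / 2)"
proof -
  define g1 where "g1 = Gamma ((real k + 1) / 2)"
  define g where "g = Gamma (real k / 2)"
  define P where "P = pi powr (real k / 2)"
  define K where "K = real k powr (real k / 2)"
  have pos: "g1 > 0" "g > 0"
    using assms by (auto simp: g1_def g_def intro!: Gamma_real_pos)
  have B: "Beta (real 1 / 2) (real k / 2) = sqrt pi * g / g1"
    by (simp add: Beta_def Gamma_one_half_real g_def g1_def add_divide_distrib add.commute)
  have G: "Gamma (real k / 2 + 1) = real k / 2 * g"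
    unfolding g_def using assms by (intro Gamma_plus1) auto
  have p: "pi powr ((real k + 1) / 2) = P * sqrt pi"
    by (simp add: P_def add_divide_distrib powr_add powr_half_sqrt)
  have c: "tail_coeff 2 1 k = K / (sqrt pi * g / g1) * (2 / (2 * real k))"
    unfolding tail_coeff_def B by (simp add: K_def)
  have v: "unit_ball_vol k = P / (real k / 2 * g)"
    unfolding unit_ball_vol_def G P_def ..
  show ?thesis
    unfolding c v p g1_def[symmetric] K_def[symmetric] using pos assms by (simp add: field_simps)
qed

text \<open>The Gamma values at m/2 and (m + k)/2 in \<open>K_g\<close> cancel against
  \<open>Beta (m/2) (k/2)\<close>, and its power of m against the denominator of
  \<open>(k / m) powr (k / 2)\<close>.\<close>

lemma F_constant:
  assumes "k > 0" "m > 0"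
  shows "Gamma (real m / 2) * (pi * real m) powr (real k / 2) / Gamma ((real m + real k) / 2) * tail_coeff 1 m k
    = unit_ball_vol k * real k powr (real k / 2)"
proof -
  define g1 where "g1 = Gamma ((real m + real k) / 2)"
  define g where "g = Gamma (real k / 2)"
  define h where "h = Gamma (real m / 2)"
  define P where "P = pi powr (real k / 2)"
  define K where "K = real k powr (real k / 2)"
  define L where "L = real m powr (real k / 2)"
  have pos: "g1 > 0" "g > 0" "h > 0" "L > 0"
    using assms by (auto simp: g1_def g_def h_def L_def intro!: Gamma_real_pos)
  have B: "Beta (real m / 2) (real k / 2) = h * g / g1"
    by (simp add: Beta_def g1_def g_def h_def add_divide_distrib)
  have G: "Gamma (real k / 2 + 1) = real k / 2 * g"
    unfolding g_def using assms by (intro Gamma_plus1) auto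
  have p: "(pi * real m) powr (real k / 2) = P * L"
    using assms by (simp add: P_def L_def powr_mult)
  have c: "tail_coeff 1 m k = K / L / (h * g / g1) * (2 / real k)"
    unfolding tail_coeff_def B using assms by (simp add: K_def L_def powr_divide)
  have v: "unit_ball_vol k = P / (real k / 2 * g)"
    unfolding unit_ball_vol_def G P_def ..
  show ?thesis
    unfolding c v p g1_def[symmetric] h_def[symmetric] K_def[symmetric] using pos assms by (simp add: field_simps)
qed

section \<open>The three inequalities\<close>

lemma one_sample_bound:
  fixes A :: "real ^ ('k::finite option) \<Rightarrow> real ^ ('k option)"
  assumes X: "has_continuous_density M X g" and A: "one_sample_rotation A" and u: "u > 0"
  shows "ennreal \<bar>measure M {s \<in> space M. one_sample_T (X s) > u} - one_sample_K g * student_tail (CARD('k option) - 1) u\<bar>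
    \<le> tail_error 2 1 (CARD('k option) - 1) (one_sample_K g) (one_sample_G A g) u"
proof -
  define k where "k = CARD('k)"
  have k: "k > 0" "CARD('k option) = Suc k"
    by (simp_all add: k_def)
  \<comment> \<open>At t = 0 the integral defining \<open>G\<close> becomes the integral in
    \<open>K_g\<close>, so both are multiples of the same J.\<close>
  have A0: "A (one_sample_v 0) = 0"
    using A by (simp add: one_sample_v_def linear_0[OF linear_append_zero] one_sample_rotation_def
        linear_0[OF orthogonal_transformation_linear])
  define J where "J = enn2real (\<integral>\<^sup>+r\<in>{0<..}. ennreal (r ^ k * g (r *\<^sub>R unit_diag)) \<partial>lborel)"
  have G0: "enn2real (one_sample_G A g 0) = real k powr (real k / 2) * J"
    unfolding one_sample_G_def k(2) A0 by (simp add: J_def enn2real_mult)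
  have K: "one_sample_K g = 2 * pi powr ((real k + 1) / 2) / Gamma ((real k + 1) / 2) * J"
    unfolding one_sample_K_def k(2) by (simp add: J_def add.commute)
  have "Gamma ((real k + 1) / 2) > 0"
    by (intro Gamma_real_pos) auto
  then have K0: "one_sample_K g \<ge> 0"
    by (simp add: K J_def)
  have KG: "one_sample_K g * tail_coeff 2 1 k = unit_ball_vol k * enn2real (one_sample_G A g 0)"
    unfolding K G0 using student_constant[OF k(1)] by (metis (no_types, opaque_lifting) mult.assoc mult.commute)
  have p: "ennreal (measure M {s \<in> space M. one_sample_T (X s) > u})
      = (\<integral>\<^sup>+t\<in>ball 0 (u powr (- real 2 / 2)). one_sample_G A g t \<partial>lborel)"
    using one_sample_prob[OF X A u] u by (simp add: powr_minus_divide)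
  have dim: "DIM(real ^ 'k) = k"
    by (simp add: k_def)
  have tl: "\<bar>student_tail k u - tail_coeff 2 1 k * u powr (- (real 2 * real k / 2))\<bar>
      \<le> tail_rest 1 k / real 2 * u powr (- (real 2 * (real k + 2) / 2))"
  proof -
    have "real 2 * real k / 2 = real k" "real 2 * (real k + 2) / 2 = real k + 2"
      by (simp_all add: field_simps)
    then show ?thesis
      using student_tail_bound[OF u k(1)] by (simp only:)
  qed
  have "ennreal \<bar>measure M {s \<in> space M. one_sample_T (X s) > u} - one_sample_K g * student_tail k u\<bar>
    \<le> tail_error 2 1 k (one_sample_K g) (one_sample_G A g) u"
    by (rule tail_error_bound[OF u _ measure_nonneg K0 dim p KG tl]) simp
  then show ?thesis
    unfolding k(2) by simp
qed

lemma two_sample_bound: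
  fixes A :: "real ^ ('p::finite option + 'q::finite option) \<Rightarrow> real ^ ('p option + 'q option)"
  assumes X: "has_continuous_density M X g" and A: "two_sample_rotation a b A" and u: "u > 0" and ab: "a > 0" "b > 0"
  shows "ennreal \<bar>measure M {s \<in> space M. two_sample_T a b (X s) > u}
        - two_sample_K a b g * student_tail (CARD('p option) + CARD('q option) - 2) u\<bar>
    \<le> tail_error 2 1 (CARD('p option) + CARD('q option) - 2) (two_sample_K a b g) (two_sample_G a b A g) u"
proof -
  define k where "k = CARD('p) + CARD('q)"
  have k: "k > 0" "CARD('p option) + CARD('q option) = Suc (Suc k)"
    by (simp_all add: k_def)
  define Mc where "Mc = two_sample_M a b CARD('p option) CARD('q option)"
  have Mc: "Mc \<ge> 0"
    by (simp add: Mc_def two_sample_M_def)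
  have "two_sample_v a b 0 \<omega> = (0 :: real ^ ('p option + 'q option))" for \<omega>
    by (auto simp: two_sample_v_def Let_def vec_eq_iff split: sum.split option.split)
  then have A0: "A (two_sample_v a b 0 \<omega>) = 0" for \<omega>
    using A by (simp add: two_sample_rotation_def linear_0[OF orthogonal_transformation_linear])
  define J where "J = enn2real (\<integral>\<^sup>+\<omega>\<in>{-pi/2..pi/2}. ennreal (cos \<omega> ^ k) *
        (\<integral>\<^sup>+r\<in>{0<..}. ennreal (r ^ (k + 1) * g (r *\<^sub>R two_sample_w \<omega>)) \<partial>lborel) \<partial>lborel)"
  have G0: "enn2real (two_sample_G a b A g 0) = Mc * J"
    unfolding two_sample_G_def Let_def k(2) A0 Mc_def[symmetric] using Mc by (simp add: J_def enn2real_mult)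
  have K: "two_sample_K a b g = 2 * pi powr ((real k + 1) / 2) * Mc / (Gamma ((real k + 1) / 2) * real k powr (real k / 2)) * J"
    unfolding two_sample_K_def Let_def k(2) Mc_def[symmetric] by (simp add: J_def add.commute)
  have "Gamma ((real k + 1) / 2) > 0"
    by (intro Gamma_real_pos) auto
  then have K0: "two_sample_K a b g \<ge> 0"
    using Mc by (simp add: K J_def)
  \<comment> \<open>The one-sample constant reappears with k = n - 2. In \<open>G\<close> the
    constant M stands in place of \<open>k powr (k / 2)\<close>, and \<open>K_g\<close> compensates
    by dividing by that power.\<close>
  have KG: "two_sample_K a b g * tail_coeff 2 1 k = unit_ball_vol k * enn2real (two_sample_G a b A g 0)"
  proof -
    have "two_sample_K a b g * tail_coeff 2 1 k
      = (2 * pi powr ((real k + 1) / 2) / Gamma ((real k + 1) / 2) * tail_coeff 2 1 k) * (Mc * J) / real k powr (real k / 2)"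
      by (simp add: K mult_ac)
    then show ?thesis
      unfolding student_constant[OF k(1)] G0 using k by simp
  qed
  have p: "ennreal (measure M {s \<in> space M. two_sample_T a b (X s) > u})
      = (\<integral>\<^sup>+t\<in>ball 0 (u powr (- real 2 / 2)). two_sample_G a b A g t \<partial>lborel)"
    using two_sample_prob[OF X A u ab] u by (simp add: powr_minus_divide)
  have dim: "DIM(real ^ ('p + 'q)) = k"
    by (simp add: k_def)
  have tl: "\<bar>student_tail k u - tail_coeff 2 1 k * u powr (- (real 2 * real k / 2))\<bar>
      \<le> tail_rest 1 k / real 2 * u powr (- (real 2 * (real k + 2) / 2))"
  proof -
    have "real 2 * real k / 2 = real k" "real 2 * (real k + 2) / 2 = real k + 2"
      by (simp_all add: field_simps)
    then show ?thesis
      using student_tail_bound[OF u k(1)] by (simp only:)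
  qed
  have "ennreal \<bar>measure M {s \<in> space M. two_sample_T a b (X s) > u} - two_sample_K a b g * student_tail k u\<bar>
    \<le> tail_error 2 1 k (two_sample_K a b g) (two_sample_G a b A g) u"
    by (rule tail_error_bound[OF u _ measure_nonneg K0 dim p KG tl]) simp
  then show ?thesis
    unfolding k(2) by simp
qed

lemma F_bound:
  fixes A :: "real ^ ('k::finite option) \<Rightarrow> real ^ ('k option)" and g :: "(real ^ 'm) \<times> (real ^ ('k option)) \<Rightarrow> real"
  assumes X: "has_continuous_density M Z g" and A: "one_sample_rotation A" and u: "u > 0" and m2: "CARD('m) \<ge> 2"
  shows "ennreal \<bar>measure M {s \<in> space M. F_T (Z s) > u} - F_K g * F_tail (CARD('m) - 1) (CARD('k option) - 1) u\<bar>
    \<le> tail_error 1 (CARD('m) - 1) (CARD('k option) - 1) (F_K g) (F_G A g) u"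
proof -
  define k where "k = CARD('k)"
  define m where "m = CARD('m) - 1"
  have k: "k > 0" "CARD('k option) = Suc k"
    by (simp_all add: k_def)
  \<comment> \<open>The first sample has no distinguished coordinate, hence an index type that is
    not an \<open>option\<close>; that its degrees of freedom are positive comes from
    \<open>m2\<close>.\<close>
  have m: "m > 0" "CARD('m) = Suc m"
    using m2 by (simp_all add: m_def)
  have A0: "A (append_zero 0) = 0"
    using A by (simp add: linear_0[OF linear_append_zero] one_sample_rotation_def
        linear_0[OF orthogonal_transformation_linear])
  define J where "J = enn2real (\<integral>\<^sup>+x. ennreal (sample_sd x ^ k) * (\<integral>\<^sup>+r. ennreal (g (x, r *\<^sub>R unit_diag)) \<partial>lborel) \<partial>lborel)"
  have G0: "enn2real (F_G A g 0) = real k powr (real k / 2) * J"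
    unfolding F_G_def Let_def k(2) A0 by (simp add: J_def enn2real_mult)
  have K: "F_K g = Gamma (real m / 2) * (pi * real m) powr (real k / 2) / Gamma ((real m + real k) / 2) * J"
    unfolding F_K_def Let_def k(2) m(2) by (simp add: J_def)
  have "Gamma ((real m + real k) / 2) > 0" "Gamma (real m / 2) > 0"
    using k m by (auto intro!: Gamma_real_pos)
  then have K0: "F_K g \<ge> 0"
    by (simp add: K J_def)
  have KG: "F_K g * tail_coeff 1 m k = unit_ball_vol k * enn2real (F_G A g 0)"
    unfolding K G0 using F_constant[OF k(1) m(1)] by (metis (no_types, opaque_lifting) mult.assoc mult.commute)
  have "u powr - (1 / 2) = 1 / sqrt u"
    using u by (simp add: powr_minus_divide powr_half_sqrt)
  then have p: "ennreal (measure M {s \<in> space M. F_T (Z s) > u})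
      = (\<integral>\<^sup>+t\<in>ball 0 (u powr (- real 1 / 2)). F_G A g t \<partial>lborel)"
    using F_prob[OF X A u] u by simp
  have dim: "DIM(real ^ 'k) = k"
    by (simp add: k_def)
  have tl: "\<bar>F_tail m k u - tail_coeff 1 m k * u powr (- (real 1 * real k / 2))\<bar>
      \<le> tail_rest m k / real 1 * u powr (- (real 1 * (real k + 2) / 2))"
    using F_tail_bound[OF u m(1) k(1)] by simp
  have "ennreal \<bar>measure M {s \<in> space M. F_T (Z s) > u} - F_K g * F_tail m k u\<bar>
    \<le> tail_error 1 m k (F_K g) (F_G A g) u"
    by (rule tail_error_bound[OF u _ measure_nonneg K0 dim p KG tl]) simp
  then show ?thesis
    unfolding k(2) m(2) by simp
qed

theorem lemma6p1:
  fixes u :: real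
  assumes "u > 0"
  shows
    "(\<forall>(M :: 'a measure) (X :: 'a \<Rightarrow> real ^ ('k::finite option)) g A.
        has_continuous_density M X g \<and> one_sample_integrable g \<and> one_sample_rotation A \<and>
        differentiable_near_0 (one_sample_G A g) \<longrightarrow>
        ennreal \<bar>measure M {s \<in> space M. one_sample_T (X s) > u}
                 - one_sample_K g * student_tail (CARD('k option) - 1) u\<bar>
        \<le> tail_error 2 1 (CARD('k option) - 1) (one_sample_K g) (one_sample_G A g) u)
     \<and>
     (\<forall>(M :: 'a measure) (X :: 'a \<Rightarrow> real ^ ('p::finite option + 'q::finite option)) g A a b.
        a > 0 \<and> b > 0 \<and>
        has_continuous_density M X g \<and> two_sample_integrable g \<and> two_sample_rotation a b A \<and>
        differentiable_near_0 (two_sample_G a b A g) \<longrightarrow>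
        ennreal \<bar>measure M {s \<in> space M. two_sample_T a b (X s) > u}
                 - two_sample_K a b g
                   * student_tail (CARD('p option) + CARD('q option) - 2) u\<bar>
        \<le> tail_error 2 1 (CARD('p option) + CARD('q option) - 2)
             (two_sample_K a b g) (two_sample_G a b A g) u)
     \<and>
     (CARD('m) \<ge> 2 \<longrightarrow>
      (\<forall>(M :: 'a measure) (Z :: 'a \<Rightarrow> (real ^ 'm) \<times> (real ^ ('k::finite option))) g A.
        has_continuous_density M Z g \<and> F_integrable g \<and> one_sample_rotation A \<and>
        differentiable_near_0 (F_G A g) \<longrightarrow>
        ennreal \<bar>measure M {s \<in> space M. F_T (Z s) > u}
                 - F_K g * F_tail (CARD('m) - 1) (CARD('k option) - 1) u\<bar>
        \<le> tail_error 1 (CARD('m) - 1) (CARD('k option) - 1) (F_K g) (F_G A g) u))"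
  using one_sample_bound[OF _ _ assms] two_sample_bound[OF _ _ assms] F_bound[OF _ _ assms]
  by blast

end
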